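(* Let $\alpha_0,\alpha_1,\alpha_2,\alpha_3$ be complex parameters with $\alpha_0+\alpha_1+2\alpha_2+\alpha_3=1$ and consider the Hamiltonian system $$\frac{dx}{dt}=\frac{\partial H}{\partial y},\quad \frac{dy}{dt}=-\frac{\partial H}{\partial x},\quad \frac{dz}{dt}=\frac{\partial H}{\partial w},\quad \frac{dw}{dt}=-\frac{\partial H}{\partial z}$$ with the polynomial Hamiltonian $H$ given by $$\begin{aligned} t^2H =\;&-tx(x-1)y^2+\{x^2+((\alpha_0+\alpha_1)t-1)x-\alpha_1 t\}y+(\alpha_2+\alpha_3)x-(\alpha_0 t-1)\alpha_1\\ &-\frac{z^2w^4}{4}+\frac{\alpha_3}{2}zw^3+\frac{1}{4}(2tz^2-\alpha_3^2)w^2-\frac{1}{2}\{(\alpha_0+\alpha_1+2\alpha_2+2\alpha_3)t-1\}zw-\frac{t^2 z^2}{4}\\ &-xzw. \end{aligned}$$ This system admits extended affine Weyl group symmetry of type $A_5^{(2)}$ as the group of its Bäcklund transformations, whose generators $s_0,s_1,s_2,s_3,\pi$ are defined as follows, with $( * ):=(x,y,z,w,t;\alpha_0,\alpha_1,\alpha_2,\alpha_3)$: $$\begin{aligned} s_0:( * ) \to &\left(x,y-\frac{\alpha_0}{x-1},z,w,t;-\alpha_0,\alpha_1,\alpha_2+\alpha_0,\alpha_3 \right),\\ s_1:( * ) \to &\left(x,y-\frac{\alpha_1}{x},z,w,t;\alpha_0,-\alpha_1,\alpha_2+\alpha_1,\alpha_3 \right),\\ s_2:( * ) \to &\left(x+\frac{\alpha_2(w^2-t)}{yw^2-ty+1},y,z+\frac{2\alpha_2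 yw}{yw^2-ty+1},w,t;\alpha_0+\alpha_2,\alpha_1+\alpha_2,-\alpha_2,\alpha_3+2\alpha_2 \right),\\ s_3:( * ) \to &\left(x,y,z,w-\frac{\alpha_3}{z},t;\alpha_0,\alpha_1,\alpha_2+\alpha_3,-\alpha_3 \right),\\ \pi:( * ) \to &\left(1-x,-y,\sqrt{-1}\,z,\frac{w}{\sqrt{-1}},-t;\alpha_1,\alpha_0,\alpha_2,\alpha_3 \right). \end{aligned}$$
   Context: A transformation written $(x,y,z,w,t;\alpha)\to(\tilde x,\tilde y,\tilde z,\tilde w,\tilde t;\tilde\alpha)$ is a Bäcklund transformation of the system if it is birational in $x,y,z,w$ and carries every solution of the system with parameters $\alpha$ and independent variable $t$ (on which the formulas are defined) to a solution of the same system with parameters $\tilde\alpha$ and independent variable $\tilde t$. Transformations are regarded as automorphisms of the field of rational functions in $x,y,z,w,t$ and the parameters (subject to the parameter relation), and products are compositions of automorphisms. The statement that the system admits extended affine Weyl group symmetry of type $A_5^{(2)}$ with generators $s_0,\dots,s_3,\pi$ means: each $s_i$ and $\pi$ is a Bäcklund transformation; $s_0,\dots,s_3$ satisfy the defining relations of the affine Weyl group $W(A_5^{(2)})$, namely $s_i^2=1$, $(s_0s_2)^3=(s_1s_2)^3=1$, $(s_2s_3)^4=1$, and $s_is_j=s_js_i$ for all other pairs; and $\pi$ realizes the diagram automorphism exchanging nodes $0$ and $1$: $\pi s_0=s_1\pi$, $\pi s_1=s_0\pi$, $\pi s_j=s_j\pi$ for $j=2,3$. *)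

theory Defs
  imports
    "HOL-Analysis.Analysis"
    "HOL-Library.Poly_Mapping"
    "HOL-Computational_Algebra.Fraction_Field"
begin

section \<open>The field of rational functions\<close>

text \<open>
  The parameters satisfy \<open>\<alpha>\<^sub>0 + \<alpha>\<^sub>1 + 2 \<alpha>\<^sub>2 + \<alpha>\<^sub>3 = 1\<close>, so the field of rational functions in
  \<open>x, y, z, w, t\<close> and the parameters, subject to this relation, is the field of rational functions
  in the eight variables below, with \<open>\<alpha>\<^sub>0\<close> standing for \<open>1 - \<alpha>\<^sub>1 - 2 \<alpha>\<^sub>2 - \<alpha>\<^sub>3\<close>.
\<close>

datatype var = VX | VY | VZ | VW | VT | VA1 | VA2 | VA3

text \<open>
  The linear order on the variables has no mathematical content; the library needs it to show
  that the polynomial ring is an integral domain.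
\<close>

primrec var_index :: "var \<Rightarrow> nat" where
  "var_index VX = 0"
| "var_index VY = 1"
| "var_index VZ = 2"
| "var_index VW = 3"
| "var_index VT = 4"
| "var_index VA1 = 5"
| "var_index VA2 = 6"
| "var_index VA3 = 7"

lemma var_index_inject: "var_index u = var_index v \<longleftrightarrow> u = v"
  by (cases u; cases v) simp_all

instantiation var :: linorder
begin

definition less_eq_var :: "var \<Rightarrow> var \<Rightarrow> bool" where
  "u \<le> v \<longleftrightarrow> var_index u \<le> var_index v"

definition less_var :: "var \<Rightarrow> var \<Rightarrow> bool" where
  "u < v \<longleftrightarrow> var_index u < var_index v"

instance
  by standard (auto simp: less_eq_var_def less_var_def simp flip: var_index_inject)

end

type_synonym pol = "(var \<Rightarrow>\<^sub>0 nat) \<Rightarrow>\<^sub>0 complex"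

type_synonym ratfun = "pol fract"

definition rconst :: "complex \<Rightarrow> ratfun" where
  "rconst c = Fract (Poly_Mapping.single 0 c) 1"

definition rvar :: "var \<Rightarrow> ratfun" where
  "rvar v = Fract (Poly_Mapping.single (Poly_Mapping.single v 1) 1) 1"

text \<open>
  Substitution of elements of a field \<open>'b\<close> for the variables, where \<open>h\<close> embeds the complex numbers
  in \<open>'b\<close>.  It is used with \<open>'b = complex\<close>, \<open>h = id\<close> (evaluation at a point) and with
  \<open>'b = ratfun\<close>, \<open>h = rconst\<close> (composition of rational functions).
\<close>

definition peval :: "(complex \<Rightarrow> 'b::field) \<Rightarrow> (var \<Rightarrow> 'b) \<Rightarrow> pol \<Rightarrow> 'b" where
  "peval h \<theta> p = (\<Sum>m\<in>Poly_Mapping.keys p.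
     h (Poly_Mapping.lookup p m) * (\<Prod>v\<in>Poly_Mapping.keys m. \<theta> v ^ Poly_Mapping.lookup m v))"

text \<open>
  A rational function is defined at \<open>\<theta>\<close> if some representation of it as a quotient of polynomials
  has a denominator that does not vanish at \<open>\<theta>\<close>; its value does not depend on this representation.
\<close>

definition defined_at :: "(complex \<Rightarrow> 'b::field) \<Rightarrow> (var \<Rightarrow> 'b) \<Rightarrow> ratfun \<Rightarrow> bool" where
  "defined_at h \<theta> r \<longleftrightarrow> (\<exists>p q. r = Fract p q \<and> peval h \<theta> q \<noteq> 0)"

definition reval :: "(complex \<Rightarrow> 'b::field) \<Rightarrow> (var \<Rightarrow> 'b) \<Rightarrow> ratfun \<Rightarrow> 'b" where
  "reval h \<theta> r = (THE b. \<exists>p q. r = Fract p q \<and> peval h \<theta> q \<noteq> 0 \<and> b = peval h \<theta> p / peval h \<theta> q)"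

section \<open>Transformations\<close>

text \<open>The nine coordinates \<open>(x, y, z, w, t; \<alpha>\<^sub>0, \<alpha>\<^sub>1, \<alpha>\<^sub>2, \<alpha>\<^sub>3)\<close>.\<close>

datatype 'a coords =
  Coords (cx: 'a) (cy: 'a) (cz: 'a) (cw: 'a) (ct: 'a) (ca0: 'a) (ca1: 'a) (ca2: 'a) (ca3: 'a)

text \<open>The entry for \<open>\<alpha>\<^sub>0\<close> is ignored here, since \<open>\<alpha>\<^sub>0\<close> is not one of the eight free variables.\<close>

fun assign :: "'a coords \<Rightarrow> var \<Rightarrow> 'a" where
  "assign (Coords x y z w t a0 a1 a2 a3) v =
     (case v of VX \<Rightarrow> x | VY \<Rightarrow> y | VZ \<Rightarrow> z | VW \<Rightarrow> w | VT \<Rightarrow> t | VA1 \<Rightarrow> a1 | VA2 \<Rightarrow> a2 | VA3 \<Rightarrow> a3)"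

text \<open>The coordinate functions themselves, as elements of the field of rational functions.\<close>

definition generic :: "ratfun coords" where
  "generic = Coords (rvar VX) (rvar VY) (rvar VZ) (rvar VW) (rvar VT)
     (1 - rvar VA1 - 2 * rvar VA2 - rvar VA3) (rvar VA1) (rvar VA2) (rvar VA3)"

text \<open>
  A transformation \<open>(x, y, z, w, t; \<alpha>) \<rightarrow> f\<close> is given by the tuple \<open>f\<close> of the nine rational
  functions replacing the coordinates.  It acts on rational functions by substitution.
\<close>

definition act :: "ratfun coords \<Rightarrow> ratfun \<Rightarrow> ratfun" where
  "act f = reval rconst (assign f)"

definition field_automorphism :: "(ratfun \<Rightarrow> ratfun) \<Rightarrow> bool" where
  "field_automorphism \<sigma> \<longleftrightarrow> bij \<sigma> \<and>
     (\<forall>r s. \<sigma> (r + s) = \<sigma> r + \<sigma> s) \<and> (\<forall>r s. \<sigma> (r * s) = \<sigma> r * \<sigma> s) \<and>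
     (\<forall>c. \<sigma> (rconst c) = rconst c)"

text \<open>The second conjunct includes that the image of \<open>\<alpha>\<^sub>0\<close> is the prescribed one.\<close>

definition acts_by_automorphism :: "ratfun coords \<Rightarrow> bool" where
  "acts_by_automorphism f \<longleftrightarrow> field_automorphism (act f) \<and> map_coords (act f) generic = f"

text \<open>
  Birationality in \<open>x, y, z, w\<close>: the rational map with components \<open>cx f, cy f, cz f, cw f\<close>, where
  \<open>t\<close> and the parameters are coefficients, has a rational inverse.
\<close>

definition freeze :: "ratfun coords \<Rightarrow> ratfun coords" where
  "freeze f = Coords (cx f) (cy f) (cz f) (cw f)
     (ct generic) (ca0 generic) (ca1 generic) (ca2 generic) (ca3 generic)"

definition left_inverse :: "ratfun coords \<Rightarrow> ratfun coords \<Rightarrow> bool" where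
  "left_inverse g f \<longleftrightarrow>
     (\<forall>r\<in>set_coords g. defined_at rconst (assign f) r) \<and> map_coords (act f) g = generic"

definition birational_xyzw :: "ratfun coords \<Rightarrow> bool" where
  "birational_xyzw f \<longleftrightarrow>
     (\<exists>g. freeze g = g \<and> left_inverse g (freeze f) \<and> left_inverse (freeze f) g)"

section \<open>The Hamiltonian system\<close>

definition ham :: "complex \<Rightarrow> complex \<Rightarrow> complex \<Rightarrow> complex \<Rightarrow> complex \<Rightarrow>
    complex \<Rightarrow> complex \<Rightarrow> complex \<Rightarrow> complex \<Rightarrow> complex" where
  "ham a0 a1 a2 a3 t x y z w =
     (- t * x * (x - 1) * y^2 + (x^2 + ((a0 + a1) * t - 1) * x - a1 * t) * y
        + (a2 + a3) * x - (a0 * t - 1) * a1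
      - z^2 * w^4 / 4 + a3 / 2 * z * w^3 + 1 / 4 * (2 * t * z^2 - a3^2) * w^2
        - 1 / 2 * ((a0 + a1 + 2 * a2 + 2 * a3) * t - 1) * z * w - t^2 * z^2 / 4
      - x * z * w) / t^2"

definition is_solution :: "complex set \<Rightarrow> (complex \<Rightarrow> complex) \<Rightarrow> (complex \<Rightarrow> complex) \<Rightarrow>
    (complex \<Rightarrow> complex) \<Rightarrow> (complex \<Rightarrow> complex) \<Rightarrow>
    complex \<Rightarrow> complex \<Rightarrow> complex \<Rightarrow> complex \<Rightarrow> bool" where
  "is_solution D x y z w a0 a1 a2 a3 \<longleftrightarrow>
     open D \<and> 0 \<notin> D \<and> a0 + a1 + 2 * a2 + a3 = 1 \<and>
     (\<forall>t\<in>D.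
        (x has_field_derivative deriv (\<lambda>v. ham a0 a1 a2 a3 t (x t) v (z t) (w t)) (y t)) (at t) \<and>
        (y has_field_derivative - deriv (\<lambda>v. ham a0 a1 a2 a3 t v (y t) (z t) (w t)) (x t)) (at t) \<and>
        (z has_field_derivative deriv (\<lambda>v. ham a0 a1 a2 a3 t (x t) (y t) (z t) v) (w t)) (at t) \<and>
        (w has_field_derivative - deriv (\<lambda>v. ham a0 a1 a2 a3 t (x t) (y t) v (w t)) (z t)) (at t))"

text \<open>
  The transformed solution is a function of the new independent variable \<open>\<tau> t\<close>, and the new
  parameters are constant along the given solution.
\<close>

definition carries_solutions :: "ratfun coords \<Rightarrow> bool" where
  "carries_solutions f \<longleftrightarrow>
     (\<forall>D x y z w a0 a1 a2 a3.
        let P = (\<lambda>t. assign (Coords (x t) (y t) (z t) (w t) t a0 a1 a2 a3));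
            \<tau> = (\<lambda>t. reval id (P t) (ct f))
        in is_solution D x y z w a0 a1 a2 a3 \<longrightarrow>
           (\<forall>t\<in>D. \<forall>r\<in>set_coords f. defined_at id (P t) r) \<longrightarrow>
           (\<exists>x' y' z' w' b0 b1 b2 b3.
              is_solution (\<tau> ` D) x' y' z' w' b0 b1 b2 b3 \<and>
              (\<forall>t\<in>D. map_coords (reval id (P t)) f =
                 Coords (x' (\<tau> t)) (y' (\<tau> t)) (z' (\<tau> t)) (w' (\<tau> t)) (\<tau> t) b0 b1 b2 b3)))"

definition baecklund_transformation :: "ratfun coords \<Rightarrow> bool" where
  "baecklund_transformation f \<longleftrightarrow> birational_xyzw f \<and> carries_solutions f"

section \<open>The generators\<close>

definition bt_s0 :: "ratfun coords" where
  "bt_s0 = (case generic of Coords x y z w t a0 a1 a2 a3 \<Rightarrow>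
     Coords x (y - a0 / (x - 1)) z w t (- a0) a1 (a2 + a0) a3)"

definition bt_s1 :: "ratfun coords" where
  "bt_s1 = (case generic of Coords x y z w t a0 a1 a2 a3 \<Rightarrow>
     Coords x (y - a1 / x) z w t a0 (- a1) (a2 + a1) a3)"

definition bt_s2 :: "ratfun coords" where
  "bt_s2 = (case generic of Coords x y z w t a0 a1 a2 a3 \<Rightarrow>
     Coords (x + a2 * (w^2 - t) / (y * w^2 - t * y + 1)) y
       (z + 2 * a2 * y * w / (y * w^2 - t * y + 1)) w t
       (a0 + a2) (a1 + a2) (- a2) (a3 + 2 * a2))"

definition bt_s3 :: "ratfun coords" where
  "bt_s3 = (case generic of Coords x y z w t a0 a1 a2 a3 \<Rightarrow>
     Coords x y z (w - a3 / z) t a0 a1 (a2 + a3) (- a3))"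

definition bt_pi :: "ratfun coords" where
  "bt_pi = (case generic of Coords x y z w t a0 a1 a2 a3 \<Rightarrow>
     Coords (1 - x) (- y) (rconst \<i> * z) (w / rconst \<i>) (- t) a1 a0 a2 a3)"

end

theory Submission
  imports Defs
begin

text \<open>
  Everything is a statement about nine explicit rational functions per generator, and the idea is to
  reduce each claim to polynomial identities.

  \<^emph>\<open>Automorphisms and relations.\<close>  Substitution of a tuple \<open>f\<close> is an everywhere defined field
  homomorphism as soon as some tuple undoes it (\<open>act_hom\<close>), and then an equation between composites need
  only be checked on the eight variables (\<open>ratfun_hom_eqI\<close>).  The \<open>s\<^sub>i\<close> are their own inverses, since
  each changes the sign of its parameter and fixes its denominator.  The commutation relations and the
  relations with \<open>\<pi>\<close> are direct.  For the two braid relations of \<open>s\<^sub>2\<close>, with \<open>s\<^sub>0\<close> and with \<open>s\<^sub>3\<close>, the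
  denominators that arise form small families of polynomials which the generators permute up to
  factors, much as tau functions do; expressed in these, the relations follow from at most
  one identity per coordinate (\<open>braid_s0_s2\<close>, \<open>braid_s2_s3\<close>).  Images of nonzero elements under a field
  homomorphism are nonzero, which takes care of all denominators.  The relation between \<open>s\<^sub>1\<close> and
  \<open>s\<^sub>2\<close> is conjugate to the one between \<open>s\<^sub>0\<close> and \<open>s\<^sub>2\<close> by \<open>\<pi>\<close>.

  \<^emph>\<open>Solutions.\<close>  Differentiating the transformed functions along a solution gives a rational expression
  in the coordinates, which has to agree with the vector field for the transformed parameters; this is
  again a polynomial identity modulo the relation that inverts the denominator (\<open>s0_flow\<close> to
  \<open>s3_flow\<close>, \<open>pi_flow\<close>).  Beforehand one has to know that a solution on which the formulas are defined
  never meets a zero of the written denominators, even for parameter values at which the numerator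
  vanishes identically; \<open>defined_at_pole\<close> shows this by varying a parameter.

  \<^emph>\<open>Birationality.\<close>  With \<open>t\<close> and the parameters as coefficients, the inverse of \<open>s\<^sub>i\<close> is
  \<open>s\<^sub>i\<close> with the opposite sign in front of its fraction.
\<close>

section \<open>Evaluation of rational functions\<close>

lemma UNIV_var: "(UNIV :: var set) = {VX, VY, VZ, VW, VT, VA1, VA2, VA3}"
  using var.exhaust by auto

lemma finite_var [simp]: "finite (A :: var set)"
  using finite_subset[OF subset_UNIV, of A] unfolding UNIV_var by simp

lemma update_eq_add_single:
  fixes p :: "'a \<Rightarrow>\<^sub>0 'b :: comm_monoid_add"
  assumes "k \<notin> Poly_Mapping.keys p"
  shows "Poly_Mapping.update k c p = p + Poly_Mapping.single k c"
  using assms by (intro poly_mapping_eqI)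
    (auto simp: lookup_update lookup_add lookup_single when_def in_keys_iff)

text \<open>
  Polynomials are generated as a ring by constants and variables.  With this rule, two ring
  homomorphisms on polynomials are compared on generators only, and any property of polynomials that
  survives sums and products needs no look at coefficients.
\<close>

lemma pol_induct [case_names const var add mult]:
  fixes p :: pol
  assumes const: "\<And>c. P (Poly_Mapping.single 0 c)"
    and var: "\<And>v. P (Poly_Mapping.single (Poly_Mapping.single v 1) 1)"
    and add: "\<And>p q. P p \<Longrightarrow> P q \<Longrightarrow> P (p + q)"
    and mult: "\<And>p q. P p \<Longrightarrow> P q \<Longrightarrow> P (p * q)"
  shows "P p"
proof -
  have power: "P (Poly_Mapping.single (Poly_Mapping.single v n) 1)" for v n
  proof (induction n)
    case 0
    then show ?case using const[of 1] by simp
  next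
    case (Suc n)
    have "Poly_Mapping.single (Poly_Mapping.single v (Suc n)) (1 :: complex)
        = Poly_Mapping.single (Poly_Mapping.single v n) 1 * Poly_Mapping.single (Poly_Mapping.single v 1) 1"
      by (simp add: mult_single flip: single_add)
    then show ?case using mult[OF Suc var] by simp
  qed
  have monomial: "P (Poly_Mapping.single m 1)" for m
  proof (induction m rule: update_induct)
    case const
    then show ?case using assms(1)[of 1] by simp
  next
    case (update m v n)
    have "Poly_Mapping.single (Poly_Mapping.update v n m) (1 :: complex)
        = Poly_Mapping.single m 1 * Poly_Mapping.single (Poly_Mapping.single v n) 1"
      using update(1) by (simp add: update_eq_add_single mult_single)
    then show ?case using mult[OF update(3) power] by simp
  qed
  have single: "P (Poly_Mapping.single m c)" for m c
    using mult[OF const[of c] monomial[of m]] by (simp add: mult_single)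
  show ?thesis
  proof (induction p rule: update_induct)
    case const
    then show ?case using assms(1)[of 0] by simp
  next
    case (update p m c)
    then show ?case using add[OF update(3) single] by (simp add: update_eq_add_single)
  qed
qed

text \<open>
  The two kinds of substitution that occur, of complex numbers and of rational functions, share the
  fact that \<open>h\<close> is a ring homomorphism, and this is all that makes \<open>peval h \<theta>\<close> one.
\<close>

locale scalar_embedding =
  fixes h :: "complex \<Rightarrow> 'b :: field"
  assumes h_one: "h 1 = 1"
    and h_add: "h (c + d) = h c + h d"
    and h_mult: "h (c * d) = h c * h d"
begin

lemma h_zero: "h 0 = 0"
  using h_add[of 0 0] by (metis add_0 add_cancel_right_right)

abbreviation monomial_value :: "(var \<Rightarrow> 'b) \<Rightarrow> (var \<Rightarrow>\<^sub>0 nat) \<Rightarrow> 'b" where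
  "monomial_value \<theta> m \<equiv> \<Prod>v\<in>UNIV. \<theta> v ^ Poly_Mapping.lookup m v"

text \<open>
  The sum over the support and the product over the variables that occur both depend on the
  polynomial.  Enlarging both index sets makes the value of a sum of polynomials computable termwise.
\<close>

lemma peval_supset:
  assumes "finite S" "Poly_Mapping.keys p \<subseteq> S"
  shows "peval h \<theta> p = (\<Sum>m\<in>S. h (Poly_Mapping.lookup p m) * monomial_value \<theta> m)"
proof -
  have "(\<Prod>v\<in>Poly_Mapping.keys m. \<theta> v ^ Poly_Mapping.lookup m v) = monomial_value \<theta> m" for m
    by (rule prod.mono_neutral_left) (auto simp: in_keys_iff)
  then show ?thesis
    unfolding peval_def using assms
    by (auto simp: in_keys_iff h_zero intro!: sum.mono_neutral_left)
qed

lemma peval_add: "peval h \<theta> (p + q) = peval h \<theta> p + peval h \<theta> q"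
proof -
  let ?S = "Poly_Mapping.keys p \<union> Poly_Mapping.keys q"
  have "peval h \<theta> r = (\<Sum>m\<in>?S. h (Poly_Mapping.lookup r m) * monomial_value \<theta> m)"
    if "Poly_Mapping.keys r \<subseteq> ?S" for r
    using that by (intro peval_supset) auto
  from this[of p] this[of q] this[of "p + q"] show ?thesis
    by (simp add: keys_add lookup_add h_add algebra_simps sum.distrib)
qed

lemma peval_single: "peval h \<theta> (Poly_Mapping.single m c) = h c * monomial_value \<theta> m"
  by (subst peval_supset[of "{m}"]) auto

lemma peval_mult: "peval h \<theta> (p * q) = peval h \<theta> p * peval h \<theta> q"
proof -
  have zero: "peval h \<theta> 0 = 0"
    by (simp add: peval_def)
  have single: "peval h \<theta> (Poly_Mapping.single m c * q) = h c * monomial_value \<theta> m * peval h \<theta> q" for m c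
  proof (induction q rule: update_induct)
    case const
    then show ?case by (simp add: zero)
  next
    case (update q n d)
    then show ?case
      by (simp add: update_eq_add_single distrib_left peval_add mult_single peval_single h_mult lookup_add
          power_add prod.distrib mult_ac)
  qed
  show ?thesis
  proof (induction p rule: update_induct)
    case const
    then show ?case by (simp add: zero)
  next
    case (update p m c)
    then show ?case
      by (simp add: update_eq_add_single distrib_right peval_add single peval_single)
  qed
qed

lemma peval_const: "peval h \<theta> (Poly_Mapping.single 0 c) = h c"
  by (simp add: peval_single)

lemma peval_var: "peval h \<theta> (Poly_Mapping.single (Poly_Mapping.single v 1) 1) = \<theta> v"
proof -
  have "monomial_value \<theta> (Poly_Mapping.single v 1) = (\<Prod>u\<in>UNIV. if u = v then \<theta> u else 1)"
    by (rule prod.cong) (auto simp: lookup_single)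
  then show ?thesis by (simp add: peval_single h_one)
qed

lemma peval_one: "peval h \<theta> 1 = 1"
  using peval_const[of \<theta> 1] by (simp add: h_one)

lemma peval_zero: "peval h \<theta> 0 = 0"
  using peval_const[of \<theta> 0] by (simp add: h_zero)

lemma peval_uminus: "peval h \<theta> (- p) = - peval h \<theta> p"
  using peval_add[of \<theta> p "- p"] by (simp add: peval_zero add_eq_0_iff)

text \<open>
  A relational form of \<open>defined_at\<close> and \<open>reval\<close> together: it composes along field operations without
  separate bookkeeping of definedness, so that evaluating an explicit rational expression amounts to
  applying introduction rules and checking that the divisors have nonzero values.
\<close>

definition takes_value :: "(var \<Rightarrow> 'b) \<Rightarrow> ratfun \<Rightarrow> 'b \<Rightarrow> bool" where
  "takes_value \<theta> r b \<longleftrightarrow>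
     (\<exists>p q. r = Fract p q \<and> peval h \<theta> q \<noteq> 0 \<and> b = peval h \<theta> p / peval h \<theta> q)"

lemma takes_value_Fract:
  "peval h \<theta> q \<noteq> 0 \<Longrightarrow> takes_value \<theta> (Fract p q) (peval h \<theta> p / peval h \<theta> q)"
  by (auto simp: takes_value_def)

lemma takes_value_Fract_one: "takes_value \<theta> (Fract p 1) (peval h \<theta> p)"
  using takes_value_Fract[of \<theta> 1 p] by (simp add: peval_one)

lemma takes_valueE:
  assumes "takes_value \<theta> r b"
  obtains p q where "r = Fract p q" "q \<noteq> 0" "peval h \<theta> q \<noteq> 0" "b = peval h \<theta> p / peval h \<theta> q"
  using assms peval_zero unfolding takes_value_def by metis

text \<open>
  Two representations of one rational function satisfy \<open>p * q' = p' * q\<close>, and evaluation preserves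
  this identity.
\<close>

lemma takes_value_unique:
  assumes "takes_value \<theta> r b" "takes_value \<theta> r c"
  shows "b = c"
proof -
  from assms(1) obtain p q where pq: "r = Fract p q" "q \<noteq> 0" "peval h \<theta> q \<noteq> 0" "b = peval h \<theta> p / peval h \<theta> q"
    by (rule takes_valueE)
  from assms(2) obtain p' q' where pq': "r = Fract p' q'" "q' \<noteq> 0" "peval h \<theta> q' \<noteq> 0" "c = peval h \<theta> p' / peval h \<theta> q'"
    by (rule takes_valueE)
  have "p * q' = p' * q"
    using pq pq' by (simp add: eq_fract)
  then have "peval h \<theta> p * peval h \<theta> q' = peval h \<theta> p' * peval h \<theta> q"
    by (metis peval_mult)
  then show ?thesis
    using pq pq' by (simp add: frac_eq_eq)
qed

lemma reval_eq:
  assumes "takes_value \<theta> r b"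
  shows "reval h \<theta> r = b"
proof -
  have "reval h \<theta> r = (THE b. takes_value \<theta> r b)"
    by (simp add: reval_def takes_value_def)
  also have "\<dots> = b"
    using assms takes_value_unique[OF _ assms] by (rule the_equality)
  finally show ?thesis .
qed

lemma defined_at_iff: "defined_at h \<theta> r \<longleftrightarrow> (\<exists>b. takes_value \<theta> r b)"
  unfolding defined_at_def takes_value_def by blast

lemma takes_value_reval: "defined_at h \<theta> r \<Longrightarrow> takes_value \<theta> r (reval h \<theta> r)"
  by (metis defined_at_iff reval_eq)

lemma takes_value_rconst: "takes_value \<theta> (rconst c) (h c)"
  using takes_value_Fract_one[of \<theta> "Poly_Mapping.single 0 c"] by (simp add: rconst_def peval_const)

lemma takes_value_rvar: "takes_value \<theta> (rvar v) (\<theta> v)"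
  using takes_value_Fract_one[of \<theta> "Poly_Mapping.single (Poly_Mapping.single v 1) 1"]
  unfolding rvar_def peval_var by simp

lemma takes_value_add:
  assumes "takes_value \<theta> r b" "takes_value \<theta> s c"
  shows "takes_value \<theta> (r + s) (b + c)"
proof -
  from assms(1) obtain p q where pq: "r = Fract p q" "q \<noteq> 0" "peval h \<theta> q \<noteq> 0" "b = peval h \<theta> p / peval h \<theta> q"
    by (rule takes_valueE)
  from assms(2) obtain p' q' where pq': "s = Fract p' q'" "q' \<noteq> 0" "peval h \<theta> q' \<noteq> 0" "c = peval h \<theta> p' / peval h \<theta> q'"
    by (rule takes_valueE)
  show ?thesis
    using takes_value_Fract[of \<theta> "q * q'" "p * q' + p' * q"] pq pq'
    by (simp add: peval_add peval_mult add_frac_eq)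
qed

lemma takes_value_mult:
  assumes "takes_value \<theta> r b" "takes_value \<theta> s c"
  shows "takes_value \<theta> (r * s) (b * c)"
proof -
  from assms(1) obtain p q where pq: "r = Fract p q" "q \<noteq> 0" "peval h \<theta> q \<noteq> 0" "b = peval h \<theta> p / peval h \<theta> q"
    by (rule takes_valueE)
  from assms(2) obtain p' q' where pq': "s = Fract p' q'" "q' \<noteq> 0" "peval h \<theta> q' \<noteq> 0" "c = peval h \<theta> p' / peval h \<theta> q'"
    by (rule takes_valueE)
  show ?thesis
    using takes_value_Fract[of \<theta> "q * q'" "p * p'"] pq pq'
    by (simp add: peval_mult)
qed

lemma takes_value_uminus:
  assumes "takes_value \<theta> r b"
  shows "takes_value \<theta> (- r) (- b)"
proof -
  from assms obtain p q where pq: "r = Fract p q" "q \<noteq> 0" "peval h \<theta> q \<noteq> 0" "b = peval h \<theta> p / peval h \<theta> q"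
    by (rule takes_valueE)
  show ?thesis
    using takes_value_Fract[of \<theta> q "- p"] pq by (simp add: peval_uminus)
qed

lemma takes_value_inverse:
  assumes "takes_value \<theta> r b" "b \<noteq> 0"
  shows "takes_value \<theta> (inverse r) (inverse b)"
  using assms(1)
proof (rule takes_valueE)
  fix p q assume pq: "r = Fract p q" "q \<noteq> 0" "peval h \<theta> q \<noteq> 0" "b = peval h \<theta> p / peval h \<theta> q"
  then show ?thesis
    using takes_value_Fract[of \<theta> p q] assms(2) by auto
qed

lemma takes_value_diff:
  "takes_value \<theta> r b \<Longrightarrow> takes_value \<theta> s c \<Longrightarrow> takes_value \<theta> (r - s) (b - c)"
  using takes_value_add[OF _ takes_value_uminus, of \<theta> r b s c] by simp

lemma takes_value_divide:
  "takes_value \<theta> r b \<Longrightarrow> takes_value \<theta> s c \<Longrightarrow> c \<noteq> 0 \<Longrightarrow> takes_value \<theta> (r / s) (b / c)"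
  using takes_value_mult[OF _ takes_value_inverse, of \<theta> r b s c] by (simp add: divide_inverse)

lemma takes_value_one: "takes_value \<theta> 1 1"
  using takes_value_Fract_one[of \<theta> 1] by (simp add: One_fract_def peval_one)

lemma takes_value_zero: "takes_value \<theta> 0 0"
  using takes_value_Fract_one[of \<theta> 0] by (simp add: Zero_fract_def peval_zero)

lemma takes_value_numeral: "takes_value \<theta> (numeral k) (numeral k)"
proof (induction k)
  case One
  show ?case using takes_value_one by simp
next
  case (Bit0 k)
  show ?case unfolding numeral_Bit0 by (intro takes_value_add Bit0)
next
  case (Bit1 k)
  show ?case unfolding numeral_Bit1 by (intro takes_value_add Bit1 takes_value_one)
qed

lemma takes_value_power: "takes_value \<theta> r b \<Longrightarrow> takes_value \<theta> (r ^ n) (b ^ n)"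
  by (induction n) (auto intro: takes_value_one takes_value_mult)

lemma takes_value_eqI: "takes_value \<theta> r b \<Longrightarrow> b = c \<Longrightarrow> takes_value \<theta> r c"
  by simp

lemmas takes_value_intros = takes_value_rconst takes_value_rvar takes_value_add takes_value_mult
  takes_value_uminus takes_value_diff takes_value_divide takes_value_one takes_value_zero
  takes_value_numeral takes_value_power

end

interpretation num: scalar_embedding "id :: complex \<Rightarrow> complex"
  by standard simp_all

interpretation rat: scalar_embedding rconst
  by standard (simp_all add: rconst_def One_fract_def single_add mult_single)

lemma isCont_peval: "isCont (\<lambda>s. peval id (\<theta>(v := s)) p) c"
proof (induction p rule: pol_induct)
  case (const c)
  show ?case unfolding num.peval_const by simp
next
  case (var u)
  show ?case unfolding num.peval_var by (cases "u = v") simp_all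
next
  case (add p q)
  then show ?case unfolding num.peval_add by (intro continuous_intros)
next
  case (mult p q)
  then show ?case unfolding num.peval_mult by (intro continuous_intros)
qed

text \<open>
  A denominator that does not vanish at a point does not vanish nearby, since polynomials are continuous.
\<close>

lemma defined_at_nearby:
  fixes \<theta> :: "var \<Rightarrow> complex"
  assumes "defined_at id \<theta> r"
  shows "\<forall>\<^sub>F s in at (\<theta> v). defined_at id (\<theta>(v := s)) r"
proof -
  obtain p q where r: "r = Fract p q" "peval id \<theta> q \<noteq> 0"
    using assms by (auto simp: defined_at_def)
  have "((\<lambda>s. peval id (\<theta>(v := s)) q) \<longlongrightarrow> peval id \<theta> q) (at (\<theta> v))"
    using isCont_peval[where \<theta> = \<theta> and v = v and p = q and c = "\<theta> v"] by (simp add: isCont_def)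
  then have "\<forall>\<^sub>F s in at (\<theta> v). peval id (\<theta>(v := s)) q \<noteq> 0"
    using r(2) by (rule tendsto_imp_eventually_ne)
  then show ?thesis
    by (rule eventually_mono) (auto simp: defined_at_def r(1))
qed

text \<open>
  A solution is assumed to avoid the points where the formulas of a transformation are undefined.
  That an apparent pole is really such a point has to be shown also when the numerator vanishes there,
  as it does in \<open>\<alpha>\<^sub>3 / z\<close> at \<open>z = 0\<close> for \<open>\<alpha>\<^sub>3 = 0\<close>.  Instead of arguing with
  irreducible denominators, one moves a single variable, in practice a parameter: definedness persists
  for nearby values, the denominator \<open>d\<close> stays zero, and the numerator \<open>n = r * d\<close> becomes nonzero.
\<close>

lemma defined_at_pole:
  fixes \<theta> :: "var \<Rightarrow> complex"
  assumes r: "defined_at id \<theta> r" and rd: "r * d = n"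
    and d: "\<And>s. num.takes_value (\<theta>(v := s)) d 0"
    and n: "\<And>s. num.takes_value (\<theta>(v := s)) n (\<nu> s)"
    and \<nu>: "\<And>s. s \<noteq> c \<Longrightarrow> \<nu> s \<noteq> 0"
  shows False
proof -
  have "\<forall>\<^sub>F s in at (\<theta> v). defined_at id (\<theta>(v := s)) r \<and> s \<noteq> c"
    using defined_at_nearby[OF r] eventually_neq_at_within by (rule eventually_conj)
  then obtain s where s: "defined_at id (\<theta>(v := s)) r" "s \<noteq> c"
    using eventually_happens[of _ "at (\<theta> v)"] by auto
  have "num.takes_value (\<theta>(v := s)) n (reval id (\<theta>(v := s)) r * 0)"
    using num.takes_value_mult[OF num.takes_value_reval[OF s(1)] d] by (simp only: rd)
  then have "\<nu> s = 0"
    using num.takes_value_unique[OF n] by simp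
  with \<nu> s(2) show False by blast
qed

section \<open>The vector field of the Hamiltonian system\<close>

text \<open>
  The right-hand sides of the four equations, multiplied by \<open>t\<^sup>2\<close>, which makes them polynomials.  The
  equation for \<open>x\<close> is free of \<open>z\<close> and \<open>w\<close>, and those for \<open>z\<close> and \<open>w\<close> are free of \<open>y\<close>; the
  argument lists reflect this.
\<close>

definition flow_x :: "complex \<Rightarrow> complex \<Rightarrow> complex \<Rightarrow> complex \<Rightarrow> complex \<Rightarrow> complex" where
  "flow_x a0 a1 t x y = - 2 * t * x * (x - 1) * y + x^2 + ((a0 + a1) * t - 1) * x - a1 * t"

definition flow_y :: "complex \<Rightarrow> complex \<Rightarrow> complex \<Rightarrow> complex \<Rightarrow> complex \<Rightarrow> complex \<Rightarrow> complex \<Rightarrow> complex \<Rightarrow> complex \<Rightarrow> complex" where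
  "flow_y a0 a1 a2 a3 t x y z w =
     t * (2 * x - 1) * y^2 - (2 * x + (a0 + a1) * t - 1) * y - (a2 + a3) + z * w"

definition flow_z :: "complex \<Rightarrow> complex \<Rightarrow> complex \<Rightarrow> complex \<Rightarrow> complex \<Rightarrow> complex \<Rightarrow> complex \<Rightarrow> complex \<Rightarrow> complex" where
  "flow_z a0 a1 a2 a3 t x z w = - (z^2 * w^3) + 3 * a3 / 2 * z * w^2 + (2 * t * z^2 - a3^2) * w / 2
     - ((a0 + a1 + 2 * a2 + 2 * a3) * t - 1) * z / 2 - x * z"

definition flow_w :: "complex \<Rightarrow> complex \<Rightarrow> complex \<Rightarrow> complex \<Rightarrow> complex \<Rightarrow> complex \<Rightarrow> complex \<Rightarrow> complex \<Rightarrow> complex" where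
  "flow_w a0 a1 a2 a3 t x z w = z * w^4 / 2 - a3 / 2 * w^3 - t * z * w^2
     + ((a0 + a1 + 2 * a2 + 2 * a3) * t - 1) * w / 2 + t^2 * z / 2 + x * w"

lemma deriv_ham:
  "deriv (\<lambda>v. ham a0 a1 a2 a3 t x v z w) y = flow_x a0 a1 t x y / t^2"
  "- deriv (\<lambda>v. ham a0 a1 a2 a3 t v y z w) x = flow_y a0 a1 a2 a3 t x y z w / t^2"
  "deriv (\<lambda>v. ham a0 a1 a2 a3 t x y z v) w = flow_z a0 a1 a2 a3 t x z w / t^2"
  "- deriv (\<lambda>v. ham a0 a1 a2 a3 t x y v w) z = flow_w a0 a1 a2 a3 t x z w / t^2"
proof -
  have divided: "deriv (\<lambda>v. F v / t^2) c = F' / t^2"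
    if "(F has_field_derivative F') (at c)" for F :: "complex \<Rightarrow> complex" and F' c
    using that by (intro DERIV_imp_deriv DERIV_cdivide)
  show "deriv (\<lambda>v. ham a0 a1 a2 a3 t x v z w) y = flow_x a0 a1 t x y / t^2"
    unfolding ham_def flow_x_def
    by (rule divided) (auto intro!: derivative_eq_intros simp: algebra_simps)
  have "deriv (\<lambda>v. ham a0 a1 a2 a3 t v y z w) x = (- flow_y a0 a1 a2 a3 t x y z w) / t^2"
    unfolding ham_def flow_y_def
    by (rule divided) (auto intro!: derivative_eq_intros simp: algebra_simps)
  then show "- deriv (\<lambda>v. ham a0 a1 a2 a3 t v y z w) x = flow_y a0 a1 a2 a3 t x y z w / t^2"
    by simp
  show "deriv (\<lambda>v. ham a0 a1 a2 a3 t x y z v) w = flow_z a0 a1 a2 a3 t x z w / t^2"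
    unfolding ham_def flow_z_def
    by (rule divided) (auto intro!: derivative_eq_intros simp: field_simps)
  have "deriv (\<lambda>v. ham a0 a1 a2 a3 t x y v w) z = (- flow_w a0 a1 a2 a3 t x z w) / t^2"
    unfolding ham_def flow_w_def
    by (rule divided) (auto intro!: derivative_eq_intros simp: field_simps)
  then show "- deriv (\<lambda>v. ham a0 a1 a2 a3 t x y v w) z = flow_w a0 a1 a2 a3 t x z w / t^2"
    by simp
qed

lemma is_solution_iff:
  "is_solution D x y z w a0 a1 a2 a3 \<longleftrightarrow>
     open D \<and> 0 \<notin> D \<and> a0 + a1 + 2 * a2 + a3 = 1 \<and>
     (\<forall>t\<in>D.
        (x has_field_derivative flow_x a0 a1 t (x t) (y t) / t^2) (at t) \<and>
        (y has_field_derivative flow_y a0 a1 a2 a3 t (x t) (y t) (z t) (w t) / t^2) (at t) \<and>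
        (z has_field_derivative flow_z a0 a1 a2 a3 t (x t) (z t) (w t) / t^2) (at t) \<and>
        (w has_field_derivative flow_w a0 a1 a2 a3 t (x t) (z t) (w t) / t^2) (at t))"
  unfolding is_solution_def deriv_ham ..

text \<open>
  The definition refers to the new time through \<open>reval\<close>.  Here it may be given as an explicit function
  \<open>\<tau>\<close>, since the fifth coordinate of the image determines it on \<open>D\<close>.
\<close>

lemma carries_solutionsI:
  assumes "\<And>D x y z w a0 a1 a2 a3.
    is_solution D x y z w a0 a1 a2 a3 \<Longrightarrow>
    (\<And>t r. t \<in> D \<Longrightarrow> r \<in> set_coords f \<Longrightarrow>
       defined_at id (assign (Coords (x t) (y t) (z t) (w t) t a0 a1 a2 a3)) r) \<Longrightarrow>
    \<exists>\<tau> x' y' z' w' b0 b1 b2 b3. is_solution (\<tau> ` D) x' y' z' w' b0 b1 b2 b3 \<and>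
      (\<forall>t\<in>D. map_coords (reval id (assign (Coords (x t) (y t) (z t) (w t) t a0 a1 a2 a3))) f
        = Coords (x' (\<tau> t)) (y' (\<tau> t)) (z' (\<tau> t)) (w' (\<tau> t)) (\<tau> t) b0 b1 b2 b3)"
  shows "carries_solutions f"
  unfolding carries_solutions_def Let_def
proof (intro allI impI)
  fix D and x y z w :: "complex \<Rightarrow> complex" and a0 a1 a2 a3 :: complex
  let ?\<theta> = "\<lambda>t. assign (Coords (x t) (y t) (z t) (w t) t a0 a1 a2 a3)"
  let ?\<tau> = "\<lambda>t. reval id (?\<theta> t) (ct f)"
  assume sol: "is_solution D x y z w a0 a1 a2 a3"
    and "\<forall>t\<in>D. \<forall>r\<in>set_coords f. defined_at id (?\<theta> t) r"
  then have def: "\<And>t r. t \<in> D \<Longrightarrow> r \<in> set_coords f \<Longrightarrow> defined_at id (?\<theta> t) r"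
    by blast
  obtain \<tau> x' y' z' w' b0 b1 b2 b3 where
    solution: "is_solution (\<tau> ` D) x' y' z' w' b0 b1 b2 b3" and
    images: "\<And>t. t \<in> D \<Longrightarrow> map_coords (reval id (?\<theta> t)) f
      = Coords (x' (\<tau> t)) (y' (\<tau> t)) (z' (\<tau> t)) (w' (\<tau> t)) (\<tau> t) b0 b1 b2 b3"
    using assms[OF sol def] by blast
  have time: "?\<tau> t = \<tau> t" if "t \<in> D" for t
    using arg_cong[OF images[OF that], of ct] by (simp add: coords.map_sel)
  then have domain: "?\<tau> ` D = \<tau> ` D"
    by (intro image_cong) simp_all
  show "\<exists>x' y' z' w' b0 b1 b2 b3. is_solution (?\<tau> ` D) x' y' z' w' b0 b1 b2 b3 \<and>
      (\<forall>t\<in>D. map_coords (reval id (?\<theta> t)) f =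
        Coords (x' (?\<tau> t)) (y' (?\<tau> t)) (z' (?\<tau> t)) (w' (?\<tau> t)) (?\<tau> t) b0 b1 b2 b3)"
    unfolding domain
    by (rule exI[of _ x'], rule exI[of _ y'], rule exI[of _ z'], rule exI[of _ w'],
      rule exI[of _ b0], rule exI[of _ b1], rule exI[of _ b2], rule exI[of _ b3])
      (intro conjI ballI solution, simp only: time images)
qed

text \<open>
  For each generator, the lemmas below say that the vector field is carried to the one with the
  transformed parameters.  For the components to which \<open>s\<^sub>i\<close> adds a fraction the left-hand side is
  literally what the rules for sums and quotients yield for the derivative along a solution, including
  zero terms where the numerator is constant, so that it can be matched with the derivation rules.
  In the proofs the inverse of the denominator is an unknown \<open>u\<close> subject to one polynomial relation,
  which leaves polynomial identities.
\<close>

lemma s0_flow: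
  fixes x y z w t a0 a1 a2 a3 :: complex
  assumes "x \<noteq> 1"
  defines "Y \<equiv> y - a0 / (x - 1)"
  shows "flow_x a0 a1 t x y = flow_x (- a0) a1 t x Y"
    and "flow_y a0 a1 a2 a3 t x y z w / t^2
        - (0 * (x - 1) - a0 * (flow_x a0 a1 t x y / t^2 - 0)) / ((x - 1) * (x - 1))
      = flow_y (- a0) a1 (a2 + a0) a3 t x Y z w / t^2"
    and "flow_z a0 a1 a2 a3 t x z w = flow_z (- a0) a1 (a2 + a0) a3 t x z w"
    and "flow_w a0 a1 a2 a3 t x z w = flow_w (- a0) a1 (a2 + a0) a3 t x z w"
proof -
  define p where "p = x - 1"
  define u where "u = inverse p"
  have u: "u * p = 1" and x: "x = p + 1"
    using assms(1) by (simp_all add: u_def p_def)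
  have Y: "Y = y - a0 * u"
    by (simp add: Y_def u_def p_def divide_inverse)
  show "flow_x a0 a1 t x y = flow_x (- a0) a1 t x Y"
    unfolding flow_x_def Y x using u by algebra
  have moved: "flow_y a0 a1 a2 a3 t x y z w + a0 * u^2 * flow_x a0 a1 t x y
      = flow_y (- a0) a1 (a2 + a0) a3 t x Y z w"
    unfolding flow_y_def flow_x_def Y x using u by algebra
  show "flow_y a0 a1 a2 a3 t x y z w / t^2
        - (0 * (x - 1) - a0 * (flow_x a0 a1 t x y / t^2 - 0)) / ((x - 1) * (x - 1))
      = flow_y (- a0) a1 (a2 + a0) a3 t x Y z w / t^2"
    unfolding moved[symmetric]
    unfolding p_def[symmetric] by (simp add: u_def divide_inverse power2_eq_square algebra_simps)
qed (simp_all add: flow_z_def flow_w_def)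

lemma s1_flow:
  fixes x y z w t a0 a1 a2 a3 :: complex
  assumes "x \<noteq> 0"
  defines "Y \<equiv> y - a1 / x"
  shows "flow_x a0 a1 t x y = flow_x a0 (- a1) t x Y"
    and "flow_y a0 a1 a2 a3 t x y z w / t^2
        - (0 * x - a1 * (flow_x a0 a1 t x y / t^2)) / (x * x)
      = flow_y a0 (- a1) (a2 + a1) a3 t x Y z w / t^2"
    and "flow_z a0 a1 a2 a3 t x z w = flow_z a0 (- a1) (a2 + a1) a3 t x z w"
    and "flow_w a0 a1 a2 a3 t x z w = flow_w a0 (- a1) (a2 + a1) a3 t x z w"
proof -
  define u where "u = inverse x"
  have u: "u * x = 1"
    using assms(1) by (simp add: u_def)
  have Y: "Y = y - a1 * u"
    by (simp add: Y_def u_def divide_inverse)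
  show "flow_x a0 a1 t x y = flow_x a0 (- a1) t x Y"
    unfolding flow_x_def Y using u by algebra
  have moved: "flow_y a0 a1 a2 a3 t x y z w + a1 * u^2 * flow_x a0 a1 t x y
      = flow_y a0 (- a1) (a2 + a1) a3 t x Y z w"
    unfolding flow_y_def flow_x_def Y using u by algebra
  show "flow_y a0 a1 a2 a3 t x y z w / t^2
        - (0 * x - a1 * (flow_x a0 a1 t x y / t^2)) / (x * x)
      = flow_y a0 (- a1) (a2 + a1) a3 t x Y z w / t^2"
    unfolding moved[symmetric]
    by (simp add: u_def divide_inverse power2_eq_square algebra_simps)
qed (simp_all add: flow_z_def flow_w_def)

lemma s3_flow:
  fixes x y z w t a0 a1 a2 a3 :: complex
  assumes "z \<noteq> 0"
  defines "W \<equiv> w - a3 / z"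
  shows "flow_y a0 a1 a2 a3 t x y z w = flow_y a0 a1 (a2 + a3) (- a3) t x y z W"
    and "flow_z a0 a1 a2 a3 t x z w = flow_z a0 a1 (a2 + a3) (- a3) t x z W"
    and "flow_w a0 a1 a2 a3 t x z w / t^2
        - (0 * z - a3 * (flow_z a0 a1 a2 a3 t x z w / t^2)) / (z * z)
      = flow_w a0 a1 (a2 + a3) (- a3) t x z W / t^2"
proof -
  define u where "u = inverse z"
  have u: "u * z = 1"
    using assms(1) by (simp add: u_def)
  have W: "W = w - a3 * u"
    by (simp add: W_def u_def divide_inverse)
  show "flow_y a0 a1 a2 a3 t x y z w = flow_y a0 a1 (a2 + a3) (- a3) t x y z W"
    unfolding flow_y_def W using u by algebra
  show "flow_z a0 a1 a2 a3 t x z w = flow_z a0 a1 (a2 + a3) (- a3) t x z W"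
    unfolding flow_z_def W using u by (simp add: field_simps) algebra
  have moved: "flow_w a0 a1 a2 a3 t x z w + a3 * u^2 * flow_z a0 a1 a2 a3 t x z w
      = flow_w a0 a1 (a2 + a3) (- a3) t x z W"
    unfolding flow_w_def flow_z_def W using u by (simp add: field_simps) algebra
  show "flow_w a0 a1 a2 a3 t x z w / t^2
        - (0 * z - a3 * (flow_z a0 a1 a2 a3 t x z w / t^2)) / (z * z)
      = flow_w a0 a1 (a2 + a3) (- a3) t x z W / t^2"
    unfolding moved[symmetric]
    by (simp add: u_def divide_inverse power2_eq_square algebra_simps)
qed

lemma s2_flow:
  fixes x y z w t a0 a1 a2 a3 :: complex
  defines "D \<equiv> y * w^2 - t * y + 1"
  assumes "D \<noteq> 0" "t \<noteq> 0" and a: "a0 = 1 - a1 - 2 * a2 - a3"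
  defines "fx \<equiv> flow_x a0 a1 t x y"
    and "fy \<equiv> flow_y a0 a1 a2 a3 t x y z w"
    and "fz \<equiv> flow_z a0 a1 a2 a3 t x z w"
    and "fw \<equiv> flow_w a0 a1 a2 a3 t x z w"
  defines "fD \<equiv> fy / t^2 * (w^2 - t) + y * (2 * w * (fw / t^2) - 1)"
    and "X \<equiv> x + a2 * (w^2 - t) / D" and "Z \<equiv> z + 2 * a2 * y * w / D"
  shows "fx / t^2 + (a2 * (2 * w * (fw / t^2) - 1) * D - a2 * (w^2 - t) * fD) / (D * D)
      = flow_x (a0 + a2) (a1 + a2) t X y / t^2"
    and "fy = flow_y (a0 + a2) (a1 + a2) (- a2) (a3 + 2 * a2) t X y Z w"
    and "fz / t^2 + (2 * a2 * (fy / t^2 * w + y * (fw / t^2)) * D - 2 * a2 * y * w * fD) / (D * D)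
      = flow_z (a0 + a2) (a1 + a2) (- a2) (a3 + 2 * a2) t X Z w / t^2"
    and "fw = flow_w (a0 + a2) (a1 + a2) (- a2) (a3 + 2 * a2) t X Z w"
proof -
  define v where "v = w^2 - t"
  define u where "u = inverse D"
  have D: "D = y * v + 1" by (simp add: D_def v_def algebra_simps)
  have u: "u * (y * v + 1) = 1"
    using \<open>D \<noteq> 0\<close> unfolding u_def by (simp flip: D)
  have X: "X = x + a2 * v * u" and Z: "Z = z + 2 * a2 * y * w * u"
    by (simp_all add: X_def Z_def v_def u_def divide_inverse)
  have XD: "X * D = x * D + a2 * v" and ZD: "Z * D = z * D + 2 * a2 * y * w"
    using \<open>D \<noteq> 0\<close> by (simp_all add: X_def Z_def v_def field_simps)
  have t: "t = w^2 - v" by (simp add: v_def)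
  show "fy = flow_y (a0 + a2) (a1 + a2) (- a2) (a3 + 2 * a2) t X y Z w"
    unfolding fy_def flow_y_def X Z a using u t by algebra
  \<comment> \<open>The transformed coordinates enter \<open>flow_w\<close> linearly, through this combination only.\<close>
  have "Z * (w^4 / 2 - t * w^2 + t^2 / 2) + X * w
      = z * (w^4 / 2 - t * w^2 + t^2 / 2) + x * w + a2 * w * v"
    unfolding X Z using u t by (simp add: field_simps) algebra
  then show "fw = flow_w (a0 + a2) (a1 + a2) (- a2) (a3 + 2 * a2) t X Z w"
    unfolding fw_def flow_w_def a t by (simp add: field_simps) algebra
  \<comment> \<open>Both \<open>X * D\<close> and \<open>Z * D\<close> are polynomials, and \<open>flow_x\<close> and \<open>flow_z\<close> are quadratic in
    \<open>X\<close> and \<open>Z\<close>: multiplication by \<open>D\<^sup>2\<close> clears all denominators.\<close>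
  have "flow_x (a0 + a2) (a1 + a2) t X y * D^2 =
     - 2 * t * (X * D) * (X * D - D) * y + (X * D)^2 + ((a0 + a1 + 2 * a2) * t - 1) * (X * D) * D
       - (a1 + a2) * t * D^2"
    by (simp add: flow_x_def algebra_simps power2_eq_square)
  also have "\<dots> = fx * D^2 + a2 * (2 * w * fw - t^2 - v^2 * fy)"
    unfolding XD
    unfolding fx_def fy_def fw_def flow_x_def flow_y_def flow_w_def a D t
    by (simp add: field_simps power2_eq_square power3_eq_cube power4_eq_xxxx)
  finally have flow_X: "flow_x (a0 + a2) (a1 + a2) t X y
      = (fx * D^2 + a2 * (2 * w * fw - t^2 - v^2 * fy)) / D^2"
    using \<open>D \<noteq> 0\<close> by (simp add: eq_divide_eq)
  have numerator_X: "a2 * (2 * w * (fw / t^2) - 1) * D - a2 * v * fD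
      = a2 * (2 * w * fw - t^2 - v^2 * fy) / t^2"
    unfolding D fD_def v_def[symmetric] using \<open>t \<noteq> 0\<close>
    by (simp add: field_simps power2_eq_square)
  show "fx / t^2 + (a2 * (2 * w * (fw / t^2) - 1) * D - a2 * (w^2 - t) * fD) / (D * D)
      = flow_x (a0 + a2) (a1 + a2) t X y / t^2"
    unfolding flow_X v_def[symmetric] numerator_X using \<open>D \<noteq> 0\<close> \<open>t \<noteq> 0\<close>
    by (simp add: field_simps power2_eq_square)
  have "flow_z (a0 + a2) (a1 + a2) (- a2) (a3 + 2 * a2) t X Z w * D^2 =
     - ((Z * D)^2 * w^3) + 3 * (a3 + 2 * a2) / 2 * (Z * D) * D * w^2
     + (2 * t * (Z * D)^2 - (a3 + 2 * a2)^2 * D^2) * w / 2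
     - ((a0 + a1 + 4 * a2 + 2 * a3) * t - 1) * (Z * D) * D / 2 - (X * D) * (Z * D)"
    by (simp add: flow_z_def field_simps power2_eq_square)
  also have "\<dots> = fz * D^2
      + 2 * a2 * (fy * w + y * fw - y^2 * fw * (w^2 + t) + w * y^2 * t^2)"
    unfolding XD ZD
    unfolding fy_def fw_def fz_def flow_z_def flow_y_def flow_w_def a D t
    by (simp add: field_simps power2_eq_square power3_eq_cube power4_eq_xxxx)
  finally have flow_Z: "flow_z (a0 + a2) (a1 + a2) (- a2) (a3 + 2 * a2) t X Z w
      = (fz * D^2 + 2 * a2 * (fy * w + y * fw - y^2 * fw * (w^2 + t) + w * y^2 * t^2)) / D^2"
    using \<open>D \<noteq> 0\<close> by (simp add: eq_divide_eq)
  have numerator_Z: "2 * a2 * (fy / t^2 * w + y * (fw / t^2)) * D - 2 * a2 * y * w * fD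
      = 2 * a2 * (fy * w + y * fw - y^2 * fw * (w^2 + t) + w * y^2 * t^2) / t^2"
    unfolding D_def fD_def using \<open>t \<noteq> 0\<close>
    by (simp add: field_simps power2_eq_square)
  show "fz / t^2 + (2 * a2 * (fy / t^2 * w + y * (fw / t^2)) * D - 2 * a2 * y * w * fD) / (D * D)
      = flow_z (a0 + a2) (a1 + a2) (- a2) (a3 + 2 * a2) t X Z w / t^2"
    unfolding flow_Z numerator_Z using \<open>D \<noteq> 0\<close> \<open>t \<noteq> 0\<close>
    by (simp add: field_simps power2_eq_square)
qed

text \<open>
  The transformation \<open>\<pi>\<close> reverses time, so the derivatives of the new functions acquire a further
  sign.  In \<open>x\<close> and \<open>y\<close> it cancels the sign of \<open>\<pi>\<close>; in \<open>z\<close> and \<open>w\<close> it turns the factors \<open>\<i>\<close> and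
  \<open>- \<i>\<close> into \<open>- \<i>\<close> and \<open>\<i>\<close>.
\<close>

lemma pi_flow:
  fixes x y z w t a0 a1 a2 a3 :: complex
  shows "flow_x a0 a1 t x y = flow_x a1 a0 (- t) (1 - x) (- y)"
    and "flow_y a0 a1 a2 a3 t x y z w = flow_y a1 a0 a2 a3 (- t) (1 - x) (- y) (\<i> * z) (w / \<i>)"
    and "- \<i> * flow_z a0 a1 a2 a3 t x z w = flow_z a1 a0 a2 a3 (- t) (1 - x) (\<i> * z) (w / \<i>)"
    and "\<i> * flow_w a0 a1 a2 a3 t x z w = flow_w a1 a0 a2 a3 (- t) (1 - x) (\<i> * z) (w / \<i>)"
proof -
  show "flow_x a0 a1 t x y = flow_x a1 a0 (- t) (1 - x) (- y)"
    by (simp add: flow_x_def algebra_simps power2_eq_square)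
  have w: "w / \<i> = - \<i> * w" by simp
  \<comment> \<open>Only \<open>\<i>\<^sup>2 = - 1\<close> matters; for a variable \<open>j\<close> the identities are polynomial.\<close>
  have gaussian: "flow_y a0 a1 a2 a3 t x y z w = flow_y a1 a0 a2 a3 (- t) (1 - x) (- y) (j * z) (- j * w)"
    "- j * flow_z a0 a1 a2 a3 t x z w = flow_z a1 a0 a2 a3 (- t) (1 - x) (j * z) (- j * w)"
    "j * flow_w a0 a1 a2 a3 t x z w = flow_w a1 a0 a2 a3 (- t) (1 - x) (j * z) (- j * w)"
    if j: "j^2 = -1" for j :: complex
  proof -
    show "flow_y a0 a1 a2 a3 t x y z w = flow_y a1 a0 a2 a3 (- t) (1 - x) (- y) (j * z) (- j * w)"
      unfolding flow_y_def using j by algebra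
    show "- j * flow_z a0 a1 a2 a3 t x z w = flow_z a1 a0 a2 a3 (- t) (1 - x) (j * z) (- j * w)"
      unfolding flow_z_def using j by (simp add: field_simps) algebra
    show "j * flow_w a0 a1 a2 a3 t x z w = flow_w a1 a0 a2 a3 (- t) (1 - x) (j * z) (- j * w)"
      unfolding flow_w_def using j by (simp add: field_simps) algebra
  qed
  show "flow_y a0 a1 a2 a3 t x y z w = flow_y a1 a0 a2 a3 (- t) (1 - x) (- y) (\<i> * z) (w / \<i>)"
    "- \<i> * flow_z a0 a1 a2 a3 t x z w = flow_z a1 a0 a2 a3 (- t) (1 - x) (\<i> * z) (w / \<i>)"
    "\<i> * flow_w a0 a1 a2 a3 t x z w = flow_w a1 a0 a2 a3 (- t) (1 - x) (\<i> * z) (w / \<i>)"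
    unfolding w by (intro gaussian; simp)+
qed

section \<open>Homomorphisms of the field of rational functions\<close>

text \<open>
  The automorphisms in question fix the constants, so they are determined by their values at the
  eight variables; relations between them become identities of eight rational functions.
\<close>

locale ratfun_hom =
  fixes \<sigma> :: "ratfun \<Rightarrow> ratfun"
  assumes add: "\<sigma> (r + s) = \<sigma> r + \<sigma> s"
    and mult: "\<sigma> (r * s) = \<sigma> r * \<sigma> s"
    and rconst: "\<sigma> (rconst c) = rconst c"
begin

lemma one: "\<sigma> 1 = 1"
  using rconst[of 1] by (simp add: rat.h_one)

lemma zero: "\<sigma> 0 = 0"
  using rconst[of 0] by (simp add: rat.h_zero)

lemma uminus: "\<sigma> (- r) = - \<sigma> r"
  using add[of r "- r"] by (simp add: zero add_eq_0_iff)

lemma diff: "\<sigma> (r - s) = \<sigma> r - \<sigma> s"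
  using add[of r "- s"] by (simp add: uminus)

lemma nonzero: "r \<noteq> 0 \<Longrightarrow> \<sigma> r \<noteq> 0"
  using mult[of r "inverse r"] by (auto simp: one)

lemma divide: "\<sigma> (r / s) = \<sigma> r / \<sigma> s"
proof (cases "s = 0")
  case False
  then have "\<sigma> (r / s) * \<sigma> s = \<sigma> r"
    by (simp flip: mult)
  then show ?thesis
    using nonzero[OF False] by (simp add: eq_divide_eq)
qed (simp add: zero)

lemma power: "\<sigma> (r ^ n) = \<sigma> r ^ n"
  by (induction n) (simp_all add: one mult)

lemma numeral: "\<sigma> (numeral k) = numeral k"
proof (induction k)
  case One
  show ?case using one by simp
next
  case (Bit0 k)
  then show ?case unfolding numeral_Bit0 add by simp
next
  case (Bit1 k)
  then show ?case unfolding numeral_Bit1 add one by simp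
qed

lemmas simps = add mult rconst one zero uminus diff divide power numeral

lemma takes_value_at_variables: "rat.takes_value (\<lambda>v. \<sigma> (rvar v)) r (\<sigma> r)"
proof (cases r)
  case (Fract p q)
  have poly: "peval rconst (\<lambda>v. \<sigma> (rvar v)) p = \<sigma> (Fract p 1)" for p
  proof (induction p rule: pol_induct)
    case (const c)
    show ?case using rconst[of c] unfolding rat.peval_const by (simp add: rconst_def)
  next
    case (var v)
    show ?case unfolding rat.peval_var by (simp add: rvar_def)
  next
    case (add p q)
    then show ?case using ratfun_hom.add[OF ratfun_hom_axioms, of "Fract p 1" "Fract q 1"]
      by (simp add: rat.peval_add)
  next
    case (mult p q)
    then show ?case using ratfun_hom.mult[OF ratfun_hom_axioms, of "Fract p 1" "Fract q 1"]
      by (simp add: rat.peval_mult)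
  qed
  have "Fract q 1 \<noteq> 0"
    using Fract by (simp add: Zero_fract_def eq_fract)
  moreover have "r = Fract p 1 / Fract q 1"
    using Fract by simp
  then have "\<sigma> r = \<sigma> (Fract p 1) / \<sigma> (Fract q 1)"
    by (simp only: divide)
  ultimately show ?thesis
    using rat.takes_value_Fract[of "\<lambda>v. \<sigma> (rvar v)" q p] Fract nonzero by (simp add: poly)
qed

end

lemma ratfun_hom_eqI:
  assumes "ratfun_hom \<sigma>" "ratfun_hom \<tau>" "\<And>v. \<sigma> (rvar v) = \<tau> (rvar v)"
  shows "\<sigma> = \<tau>"
proof
  fix r
  show "\<sigma> r = \<tau> r"
    using ratfun_hom.takes_value_at_variables[OF assms(1), of r]
      ratfun_hom.takes_value_at_variables[OF assms(2), of r]
    by (simp add: assms(3) rat.takes_value_unique)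
qed

lemma ratfun_hom_id: "ratfun_hom id"
  by standard simp_all

lemma ratfun_hom_comp: "ratfun_hom \<sigma> \<Longrightarrow> ratfun_hom \<tau> \<Longrightarrow> ratfun_hom (\<sigma> \<circ> \<tau>)"
  by (auto simp: ratfun_hom_def)

lemma act_rvar: "act f (rvar v) = assign f v"
  unfolding act_def by (rule rat.reval_eq) (rule rat.takes_value_rvar)

lemma left_inverseI:
  assumes "rat.takes_value (assign f) x (rvar VX)"
    and "rat.takes_value (assign f) y (rvar VY)"
    and "rat.takes_value (assign f) z (rvar VZ)"
    and "rat.takes_value (assign f) w (rvar VW)"
    and "rat.takes_value (assign f) t (rvar VT)"
    and "rat.takes_value (assign f) a0 (1 - rvar VA1 - 2 * rvar VA2 - rvar VA3)"
    and "rat.takes_value (assign f) a1 (rvar VA1)"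
    and "rat.takes_value (assign f) a2 (rvar VA2)"
    and "rat.takes_value (assign f) a3 (rvar VA3)"
  shows "left_inverse (Coords x y z w t a0 a1 a2 a3) f"
  unfolding left_inverse_def generic_def act_def
  using assms by (auto simp: rat.defined_at_iff rat.reval_eq)

lemma left_inverse_takes_value:
  assumes "left_inverse g f"
  shows "rat.takes_value (assign f) (assign g v) (rvar v)"
proof -
  obtain x y z w t a0 a1 a2 a3 where g: "g = Coords x y z w t a0 a1 a2 a3"
    by (cases g)
  have "assign g v \<in> set_coords g"
    unfolding g by (cases v) simp_all
  then have "rat.takes_value (assign f) (assign g v) (act f (assign g v))"
    using assms unfolding left_inverse_def act_def by (simp add: rat.takes_value_reval)
  moreover have "act f (assign g v) = rvar v"
    using assms unfolding left_inverse_def g generic_def by (cases v) simp_all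
  ultimately show ?thesis by simp
qed

text \<open>
  For substitution to be a homomorphism on the whole field, no nonzero polynomial \<open>q\<close> may become
  zero under the substitution of \<open>f\<close>, since \<open>q\<close> occurs as a denominator.  A left inverse guarantees this:
  substituting \<open>g\<close> in the result recovers \<open>q\<close>.
\<close>

lemma act_hom:
  assumes "left_inverse f g"
  shows "ratfun_hom (act f)"
proof -
  have cancel: "rat.takes_value (assign g) (peval rconst (assign f) p) (Fract p 1)" for p
  proof (induction p rule: pol_induct)
    case (const c)
    show ?case using rat.takes_value_rconst[of "assign g" c]
      unfolding rat.peval_const by (simp flip: rconst_def)
  next
    case (var v)
    show ?case using left_inverse_takes_value[OF assms, of v]
      unfolding rat.peval_var by (simp add: rvar_def)
  next
    case (add p q)
    then show ?case using rat.takes_value_add by (fastforce simp: rat.peval_add)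
  next
    case (mult p q)
    then show ?case using rat.takes_value_mult by (fastforce simp: rat.peval_mult)
  qed
  have injective: "peval rconst (assign f) q \<noteq> 0" if "q \<noteq> 0" for q
  proof
    assume "peval rconst (assign f) q = 0"
    then have "Fract q 1 = 0"
      using cancel[of q] rat.takes_value_zero rat.takes_value_unique by metis
    with that show False by (simp add: Zero_fract_def eq_fract)
  qed
  have total: "rat.takes_value (assign f) r (act f r)" for r
  proof (cases r)
    case (Fract p q)
    then show ?thesis
      unfolding act_def using rat.takes_value_Fract[OF injective, of q p] by (simp add: rat.reval_eq)
  qed
  show ?thesis
  proof
    show "act f (r + s) = act f r + act f s" for r s
      using rat.takes_value_unique[OF total rat.takes_value_add[OF total total]] .
    show "act f (r * s) = act f r * act f s" for r s
      using rat.takes_value_unique[OF total rat.takes_value_mult[OF total total]] .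
    show "act f (rconst c) = rconst c" for c
      using rat.takes_value_unique[OF total rat.takes_value_rconst] .
  qed
qed

lemma act_left_inverse:
  assumes "left_inverse f g" "left_inverse g f"
  shows "act f \<circ> act g = id"
proof (rule ratfun_hom_eqI)
  show "ratfun_hom (act f \<circ> act g)"
    using act_hom assms ratfun_hom_comp by blast
  show "(act f \<circ> act g) (rvar v) = id (rvar v)" for v
    using rat.reval_eq[OF left_inverse_takes_value[OF assms(2)], of v]
    by (simp add: act_rvar flip: act_def)
qed (rule ratfun_hom_id)

lemma acts_by_automorphismI:
  assumes "left_inverse f g" "left_inverse g f"
    and relation: "ca0 f = 1 - ca1 f - 2 * ca2 f - ca3 f"
  shows "acts_by_automorphism f"
proof -
  interpret ratfun_hom "act f"
    using assms(1) by (rule act_hom)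
  have "bij (act f)"
    using act_left_inverse[OF assms(1,2)] act_left_inverse[OF assms(2,1)] by (rule o_bij[rotated])
  moreover have "map_coords (act f) generic = f"
    using relation by (simp add: generic_def simps act_rvar) (cases f, simp)
  ultimately show ?thesis
    by (simp add: acts_by_automorphism_def field_automorphism_def simps)
qed

section \<open>The generators as automorphisms\<close>

text \<open>
  Explicit rational functions are recognized as nonzero by their value at one point.
\<close>

lemma nonzero_if_value_nonzero: "num.takes_value \<theta> r b \<Longrightarrow> b \<noteq> 0 \<Longrightarrow> r \<noteq> 0"
  using num.takes_value_unique num.takes_value_zero by blast

abbreviation "X \<equiv> rvar VX"
abbreviation "Y \<equiv> rvar VY"
abbreviation "Z \<equiv> rvar VZ"
abbreviation "W \<equiv> rvar VW"
abbreviation "T \<equiv> rvar VT"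
abbreviation "A0 \<equiv> 1 - rvar VA1 - 2 * rvar VA2 - rvar VA3"
abbreviation "A1 \<equiv> rvar VA1"
abbreviation "A2 \<equiv> rvar VA2"
abbreviation "A3 \<equiv> rvar VA3"
abbreviation "D2 \<equiv> Y * W^2 - T * Y + 1"

lemma denominators_nonzero: "X \<noteq> 0" "X \<noteq> 1" "Y \<noteq> 0" "Z \<noteq> 0" "D2 \<noteq> 0"
proof -
  show "X \<noteq> 0"
    by (rule nonzero_if_value_nonzero[of "\<lambda>_. 1"], (rule num.takes_value_intros)+, simp)
  show "Y \<noteq> 0"
    by (rule nonzero_if_value_nonzero[of "\<lambda>_. 1"], (rule num.takes_value_intros)+, simp)
  show "Z \<noteq> 0"
    by (rule nonzero_if_value_nonzero[of "\<lambda>_. 1"], (rule num.takes_value_intros)+, simp)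
  have "X - 1 \<noteq> 0"
    by (rule nonzero_if_value_nonzero[of "\<lambda>_. 0"], (rule num.takes_value_intros)+, simp)
  then show "X \<noteq> 1" by simp
  show "D2 \<noteq> 0"
    by (rule nonzero_if_value_nonzero[of "\<lambda>_. 0"], (rule num.takes_value_intros)+, simp)
qed

lemmas bt_defs = bt_s0_def bt_s1_def bt_s2_def bt_s3_def bt_pi_def

lemma rconst_i: "rconst \<i> \<noteq> 0"  "rconst \<i> * rconst \<i> = - 1" "rconst \<i> * (rconst \<i> * r) = - r"
proof -
  show 1: "rconst \<i> * rconst \<i> = - 1"
    using rat.h_add[of 1 "-1"] by (simp add: rat.h_zero rat.h_one eq_neg_iff_add_eq_0 add.commute flip: rat.h_mult)
  then show "rconst \<i> \<noteq> 0" by auto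
  show "rconst \<i> * (rconst \<i> * r) = - r"
    by (simp add: 1 flip: mult.assoc)
qed

text \<open>
  Each \<open>s\<^sub>i\<close> changes the sign of its own parameter and fixes its denominator, so a second application
  subtracts what the first one added.
\<close>

lemma s0_involution: "left_inverse bt_s0 bt_s0"
proof -
  have reflect: "1 - A1 - 2 * (A2 + A0) - A3 = - A0"
    by (simp add: algebra_simps)
  show ?thesis
    unfolding bt_s0_def generic_def coords.case
    by (rule left_inverseI; rule rat.takes_value_eqI)
    (rule rat.takes_value_intros | (simp add: denominators_nonzero; fail) |
        (simp only: assign.simps var.case reflect minus_divide_left[symmetric] diff_minus_eq_add
          diff_add_cancel; fail))+
qed

lemma s1_involution: "left_inverse bt_s1 bt_s1"
  unfolding bt_s1_def generic_def coords.case
  by (rule left_inverseI; rule rat.takes_value_eqI)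
    (rule rat.takes_value_intros | (simp add: denominators_nonzero; fail))+

lemma s2_involution: "left_inverse bt_s2 bt_s2"
  unfolding bt_s2_def generic_def coords.case
  by (rule left_inverseI; rule rat.takes_value_eqI)
    (rule rat.takes_value_intros | (simp add: denominators_nonzero; fail))+

lemma s3_involution: "left_inverse bt_s3 bt_s3"
  unfolding bt_s3_def generic_def coords.case
  by (rule left_inverseI; rule rat.takes_value_eqI)
    (rule rat.takes_value_intros | (simp add: denominators_nonzero; fail))+

text \<open>
  In contrast to the \<open>s\<^sub>i\<close>, the transformation \<open>\<pi>\<close> has order four: \<open>\<pi>\<^sup>2\<close> changes the signs of
  \<open>z\<close> and \<open>w\<close>.
\<close>

definition bt_pi_inverse :: "ratfun coords" where
  "bt_pi_inverse = Coords (1 - X) (- Y) (- rconst \<i> * Z) (- W / rconst \<i>) (- T) A1 A0 A2 A3"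

lemma pi_left_inverse: "left_inverse bt_pi bt_pi_inverse"
  unfolding bt_pi_def bt_pi_inverse_def generic_def coords.case
  by (rule left_inverseI; rule rat.takes_value_eqI)
    (rule rat.takes_value_intros | (simp add: rconst_i; fail))+

lemma pi_right_inverse: "left_inverse bt_pi_inverse bt_pi"
  unfolding bt_pi_def bt_pi_inverse_def generic_def coords.case
  by (rule left_inverseI; rule rat.takes_value_eqI)
    (rule rat.takes_value_intros | (simp add: rconst_i; fail))+

interpretation s0: ratfun_hom "act bt_s0" by (rule act_hom) (rule s0_involution)
interpretation s1: ratfun_hom "act bt_s1" by (rule act_hom) (rule s1_involution)
interpretation s2: ratfun_hom "act bt_s2" by (rule act_hom) (rule s2_involution)
interpretation s3: ratfun_hom "act bt_s3" by (rule act_hom) (rule s3_involution)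
interpretation pi: ratfun_hom "act bt_pi" by (rule act_hom) (rule pi_left_inverse)

lemma automorphisms:
  "acts_by_automorphism bt_s0" "acts_by_automorphism bt_s1" "acts_by_automorphism bt_s2"
  "acts_by_automorphism bt_s3" "acts_by_automorphism bt_pi"
  using s0_involution s1_involution s2_involution s3_involution pi_left_inverse pi_right_inverse
  by (auto intro!: acts_by_automorphismI simp: bt_defs generic_def)

section \<open>Birationality\<close>

text \<open>
  With \<open>t\<close> and the parameters kept as coefficients, the inverse of \<open>s\<^sub>i\<close> is obtained by reversing the
  sign of its fractions: these involve, apart from the coefficients, only coordinates that
  \<open>s\<^sub>i\<close> fixes.
\<close>

lemma birational_s0: "birational_xyzw bt_s0"
  unfolding birational_xyzw_def
proof (intro exI conjI)
  let ?g = "Coords X (Y + A0 / (X - 1)) Z W T A0 A1 A2 A3"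
  show "freeze ?g = ?g"
    by (simp add: freeze_def generic_def)
  show "left_inverse ?g (freeze bt_s0)"
    unfolding bt_s0_def generic_def freeze_def coords.case coords.sel
    by (rule left_inverseI; rule rat.takes_value_eqI)
    (rule rat.takes_value_intros | (simp add: denominators_nonzero; fail))+
  show "left_inverse (freeze bt_s0) ?g"
    unfolding bt_s0_def generic_def freeze_def coords.case coords.sel
    by (rule left_inverseI; rule rat.takes_value_eqI)
    (rule rat.takes_value_intros | (simp add: denominators_nonzero; fail))+
qed

lemma birational_s1: "birational_xyzw bt_s1"
  unfolding birational_xyzw_def
proof (intro exI conjI)
  let ?g = "Coords X (Y + A1 / X) Z W T A0 A1 A2 A3"
  show "freeze ?g = ?g"
    by (simp add: freeze_def generic_def)
  show "left_inverse ?g (freeze bt_s1)"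
    unfolding bt_s1_def generic_def freeze_def coords.case coords.sel
    by (rule left_inverseI; rule rat.takes_value_eqI)
    (rule rat.takes_value_intros | (simp add: denominators_nonzero; fail))+
  show "left_inverse (freeze bt_s1) ?g"
    unfolding bt_s1_def generic_def freeze_def coords.case coords.sel
    by (rule left_inverseI; rule rat.takes_value_eqI)
    (rule rat.takes_value_intros | (simp add: denominators_nonzero; fail))+
qed

lemma birational_s2: "birational_xyzw bt_s2"
  unfolding birational_xyzw_def
proof (intro exI conjI)
  let ?g = "Coords (X - A2 * (W^2 - T) / D2) Y (Z - 2 * A2 * Y * W / D2) W T A0 A1 A2 A3"
  show "freeze ?g = ?g"
    by (simp add: freeze_def generic_def)
  show "left_inverse ?g (freeze bt_s2)"
    unfolding bt_s2_def generic_def freeze_def coords.case coords.sel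
    by (rule left_inverseI; rule rat.takes_value_eqI)
    (rule rat.takes_value_intros | (simp add: denominators_nonzero; fail))+
  show "left_inverse (freeze bt_s2) ?g"
    unfolding bt_s2_def generic_def freeze_def coords.case coords.sel
    by (rule left_inverseI; rule rat.takes_value_eqI)
    (rule rat.takes_value_intros | (simp add: denominators_nonzero; fail))+
qed

lemma birational_s3: "birational_xyzw bt_s3"
  unfolding birational_xyzw_def
proof (intro exI conjI)
  let ?g = "Coords X Y Z (W + A3 / Z) T A0 A1 A2 A3"
  show "freeze ?g = ?g"
    by (simp add: freeze_def generic_def)
  show "left_inverse ?g (freeze bt_s3)"
    unfolding bt_s3_def generic_def freeze_def coords.case coords.sel
    by (rule left_inverseI; rule rat.takes_value_eqI)
    (rule rat.takes_value_intros | (simp add: denominators_nonzero; fail))+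
  show "left_inverse (freeze bt_s3) ?g"
    unfolding bt_s3_def generic_def freeze_def coords.case coords.sel
    by (rule left_inverseI; rule rat.takes_value_eqI)
    (rule rat.takes_value_intros | (simp add: denominators_nonzero; fail))+
qed

lemma birational_pi: "birational_xyzw bt_pi"
  unfolding birational_xyzw_def
proof (intro exI conjI)
  let ?g = "freeze bt_pi_inverse"
  show "freeze ?g = ?g"
    by (simp add: freeze_def generic_def)
  show "left_inverse ?g (freeze bt_pi)"
    unfolding bt_pi_def bt_pi_inverse_def generic_def freeze_def coords.case coords.sel
    by (rule left_inverseI; rule rat.takes_value_eqI)
    (rule rat.takes_value_intros | (simp add: rconst_i; fail))+
  show "left_inverse (freeze bt_pi) ?g"
    unfolding bt_pi_def bt_pi_inverse_def generic_def freeze_def coords.case coords.sel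
    by (rule left_inverseI; rule rat.takes_value_eqI)
    (rule rat.takes_value_intros | (simp add: rconst_i; fail))+
qed

section \<open>Relations\<close>

lemma s0_rvar:
  "act bt_s0 X = X" "act bt_s0 Y = Y - A0 / (X - 1)" "act bt_s0 Z = Z" "act bt_s0 W = W"
  "act bt_s0 T = T" "act bt_s0 A1 = A1" "act bt_s0 A2 = A2 + A0" "act bt_s0 A3 = A3"
  by (simp_all add: act_rvar bt_s0_def generic_def)

lemma s1_rvar:
  "act bt_s1 X = X" "act bt_s1 Y = Y - A1 / X" "act bt_s1 Z = Z" "act bt_s1 W = W"
  "act bt_s1 T = T" "act bt_s1 A1 = - A1" "act bt_s1 A2 = A2 + A1" "act bt_s1 A3 = A3"
  by (simp_all add: act_rvar bt_s1_def generic_def)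

lemma s2_rvar:
  "act bt_s2 X = X + A2 * (W^2 - T) / D2" "act bt_s2 Y = Y"
  "act bt_s2 Z = Z + 2 * A2 * Y * W / D2" "act bt_s2 W = W" "act bt_s2 T = T"
  "act bt_s2 A1 = A1 + A2" "act bt_s2 A2 = - A2" "act bt_s2 A3 = A3 + 2 * A2"
  by (simp_all add: act_rvar bt_s2_def generic_def)

lemma s3_rvar:
  "act bt_s3 X = X" "act bt_s3 Y = Y" "act bt_s3 Z = Z" "act bt_s3 W = W - A3 / Z"
  "act bt_s3 T = T" "act bt_s3 A1 = A1" "act bt_s3 A2 = A2 + A3" "act bt_s3 A3 = - A3"
  by (simp_all add: act_rvar bt_s3_def generic_def)

lemma pi_rvar:
  "act bt_pi X = 1 - X" "act bt_pi Y = - Y" "act bt_pi Z = rconst \<i> * Z"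
  "act bt_pi W = W / rconst \<i>" "act bt_pi T = - T" "act bt_pi A1 = A0"
  "act bt_pi A2 = A2" "act bt_pi A3 = A3"
  by (simp_all add: act_rvar bt_pi_def generic_def)

lemmas rvar_images = s0_rvar s1_rvar s2_rvar s3_rvar pi_rvar
lemmas hom_simps = s0.simps s1.simps s2.simps s3.simps pi.simps

lemmas homs = s0.ratfun_hom_axioms s1.ratfun_hom_axioms s2.ratfun_hom_axioms
  s3.ratfun_hom_axioms pi.ratfun_hom_axioms

lemma commutes_s0_s1: "act bt_s0 \<circ> act bt_s1 = act bt_s1 \<circ> act bt_s0"
proof (rule ratfun_hom_eqI)
  fix v show "(act bt_s0 \<circ> act bt_s1) (rvar v) = (act bt_s1 \<circ> act bt_s0) (rvar v)"
    by (cases v) (simp_all add: rvar_images hom_simps)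
qed (intro ratfun_hom_comp homs)+

lemma commutes_s0_s3: "act bt_s0 \<circ> act bt_s3 = act bt_s3 \<circ> act bt_s0"
proof (rule ratfun_hom_eqI)
  fix v show "(act bt_s0 \<circ> act bt_s3) (rvar v) = (act bt_s3 \<circ> act bt_s0) (rvar v)"
    by (cases v) (simp_all add: rvar_images hom_simps)
qed (intro ratfun_hom_comp homs)+

lemma commutes_s1_s3: "act bt_s1 \<circ> act bt_s3 = act bt_s3 \<circ> act bt_s1"
proof (rule ratfun_hom_eqI)
  fix v show "(act bt_s1 \<circ> act bt_s3) (rvar v) = (act bt_s3 \<circ> act bt_s1) (rvar v)"
    by (cases v) (simp_all add: rvar_images hom_simps)
qed (intro ratfun_hom_comp homs)+

lemma W_div_i: "W / rconst \<i> = - rconst \<i> * W"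
  using rconst_i(1) rconst_i(3)[of W] by (simp add: divide_eq_eq mult_ac)

lemma W_div_i_square: "(W / rconst \<i>)^2 = - (W^2)"
  by (simp add: power_divide power2_eq_square rconst_i)

lemma pi_s0: "act bt_pi \<circ> act bt_s0 = act bt_s1 \<circ> act bt_pi"
proof (rule ratfun_hom_eqI)
  have "- Y - A1 / ((1 - X) - 1) = - (Y - A1 / X)" by simp
  then show "(act bt_pi \<circ> act bt_s0) (rvar v) = (act bt_s1 \<circ> act bt_pi) (rvar v)" for v
    by (cases v) (simp_all add: rvar_images hom_simps)
qed (intro ratfun_hom_comp homs)+

lemma pi_s1: "act bt_pi \<circ> act bt_s1 = act bt_s0 \<circ> act bt_pi"
proof (rule ratfun_hom_eqI)
  have "A0 / (1 - X) = - (A0 / (X - 1))"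
    by (simp add: minus_divide_right)
  then show "(act bt_pi \<circ> act bt_s1) (rvar v) = (act bt_s0 \<circ> act bt_pi) (rvar v)" for v
    by (cases v) (simp_all add: rvar_images hom_simps)
qed (intro ratfun_hom_comp homs)+

lemma pi_s2: "act bt_pi \<circ> act bt_s2 = act bt_s2 \<circ> act bt_pi"
proof (rule ratfun_hom_eqI)
  fix v
  have D: "act bt_pi D2 = D2"
    by (simp add: rvar_images hom_simps power_divide power2_eq_square rconst_i)
  have Z: "2 * A2 * - Y * (W / rconst \<i>) = rconst \<i> * (2 * A2 * Y * W)"
    by (simp add: W_div_i mult_ac)
  have X: "A2 * ((W / rconst \<i>)\<^sup>2 - - T) = - (A2 * (W^2 - T))"
    unfolding W_div_i_square by (simp add: algebra_simps)
  show "(act bt_pi \<circ> act bt_s2) (rvar v) = (act bt_s2 \<circ> act bt_pi) (rvar v)"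
  proof (cases v)
    case VX
    have *: "act bt_pi (A2 * (W^2 - T)) = - (A2 * (W^2 - T))"
      using X by (simp only: pi_rvar pi.simps)
    show ?thesis
      unfolding VX by (simp only: o_apply s2_rvar pi.add[of X] pi.divide[of _ D2] D *)
        (simp add: pi_rvar s2_rvar s2.simps)
  next
    case VZ
    have *: "act bt_pi (2 * A2 * Y * W) = rconst \<i> * (2 * A2 * Y * W)"
      using Z by (simp add: pi_rvar pi.simps)
    show ?thesis
      unfolding VZ by (simp only: o_apply s2_rvar pi.add[of Z] pi.divide[of _ D2] D *)
        (simp add: pi_rvar s2_rvar s2.simps distrib_left)
  qed (simp_all add: rvar_images hom_simps)
qed (intro ratfun_hom_comp homs)+

lemma pi_s3: "act bt_pi \<circ> act bt_s3 = act bt_s3 \<circ> act bt_pi"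
proof (rule ratfun_hom_eqI)
  show "(act bt_pi \<circ> act bt_s3) (rvar v) = (act bt_s3 \<circ> act bt_pi) (rvar v)" for v
    by (cases v) (simp_all add: rvar_images hom_simps diff_divide_distrib mult_ac)
qed (intro ratfun_hom_comp homs)+

lemma involutions:
  "act bt_s0 \<circ> act bt_s0 = id" "act bt_s1 \<circ> act bt_s1 = id"
  "act bt_s2 \<circ> act bt_s2 = id" "act bt_s3 \<circ> act bt_s3 = id"
  by (rule act_left_inverse; rule s0_involution s1_involution s2_involution s3_involution)+

text \<open>
  Composing the formulas blindly makes the denominators grow.  They stay under control because all
  that appear are products of powers of four polynomials, which \<open>s\<^sub>0\<close> and \<open>s\<^sub>2\<close> permute up to factors:
  \<open>s\<^sub>0\<close> exchanges \<open>D\<close> and \<open>K\<close> and fixes \<open>N\<close>, and \<open>s\<^sub>2\<close> exchanges \<open>p\<close> and \<open>N\<close> and fixes \<open>K\<close>.  The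
  polynomials \<open>K\<close> and \<open>N\<close> are nonzero as numerators of images of nonzero elements.  The braid
  relation at \<open>x\<close>, \<open>y\<close> and \<open>z\<close> then reduces to the single identity \<open>key\<close> between the four.
\<close>

lemma braid_s0_s2:
  "act bt_s0 \<circ> act bt_s2 \<circ> act bt_s0 = act bt_s2 \<circ> act bt_s0 \<circ> act bt_s2"
proof (rule ratfun_hom_eqI)
  \<comment> \<open>Naming \<open>\<alpha>\<^sub>0\<close> keeps the simplifier from expanding it in the other parameters.\<close>
  define a0 where "a0 = A0"
  define p where "p = X - 1"
  define V where "V = W^2 - T"
  define D where "D = Y * V + 1"
  define K where "K = p * D - a0 * V"
  define N where "N = p * D + A2 * V"
  have D2: "D2 = D"
    by (simp add: D_def V_def algebra_simps)
  have nz: "D \<noteq> 0" "p \<noteq> 0"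
    using denominators_nonzero unfolding D2 p_def by simp_all
  have s0: "act bt_s0 X = X" "act bt_s0 Y = Y - a0 / p" "act bt_s0 Z = Z" "act bt_s0 W = W"
    "act bt_s0 T = T" "act bt_s0 A1 = A1" "act bt_s0 A2 = A2 + a0" "act bt_s0 A3 = A3"
    "act bt_s0 a0 = - a0" "act bt_s0 p = p" "act bt_s0 V = V"
    by (simp_all add: a0_def p_def V_def s0_rvar s0.simps)
  have s2: "act bt_s2 X = X + A2 * V / D" "act bt_s2 Y = Y"
    "act bt_s2 Z = Z + 2 * A2 * Y * W / D" "act bt_s2 W = W" "act bt_s2 T = T"
    "act bt_s2 A1 = A1 + A2" "act bt_s2 A2 = - A2" "act bt_s2 A3 = A3 + 2 * A2"
    "act bt_s2 a0 = a0 + A2" "act bt_s2 V = V"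
    by (simp_all add: a0_def V_def s2_rvar s2.simps D2)
  have s2_D: "act bt_s2 D = D"
    by (simp add: D_def s2.simps s2)
  have s2_p: "act bt_s2 p = N / D"
    using nz by (simp add: p_def s2.simps s2 N_def) (simp add: field_simps)
  have s0_D: "act bt_s0 D = K / p"
    using nz(2) by (simp add: D_def s0.simps s0 K_def) (simp add: field_simps)
  have s2_K: "act bt_s2 K = K"
    using nz by (simp add: K_def s2.simps s2 s2_p s2_D) (simp add: N_def algebra_simps)
  have s0_N: "act bt_s0 N = N"
    using nz by (simp add: N_def s0.simps s0 s0_D) (simp add: K_def algebra_simps)
  have K0: "K \<noteq> 0"
    using s0.nonzero[OF nz(1)] s0_D by auto
  have N0: "N \<noteq> 0"
    using s2.nonzero[OF nz(2)] s2_p by auto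
  have key: "A2 * K + a0 * N = (a0 + A2) * (p * D)"
    by (simp add: K_def N_def algebra_simps)
  note images = s0 s2 s2_D s2_p s0_D s2_K s0_N hom_simps
  fix v
  show "(act bt_s0 \<circ> act bt_s2 \<circ> act bt_s0) (rvar v)
      = (act bt_s2 \<circ> act bt_s0 \<circ> act bt_s2) (rvar v)"
  proof (cases v)
    case VX
    have *: "(A2 + a0) * V / (K / p) = A2 * V / D + a0 * V / (K / (N / D))"
      using nz K0 N0 key by (simp add: divide_simps) algebra
    show ?thesis unfolding VX by (simp add: images) (use * in simp)
  next
    case VY
    have *: "a0 / p + A2 / (N / (K / p)) = (a0 + A2) / (N / D)"
      using nz K0 N0 key by (simp add: divide_simps) algebra
    show ?thesis unfolding VY by (simp add: images) (use * in \<open>simp add: algebra_simps\<close>)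
  next
    case VZ
    have *: "2 * (A2 + a0) * (Y - a0 / p) * W / (K / p)
      = 2 * A2 * Y * W / D + 2 * a0 * (Y - (a0 + A2) / (N / D)) * W / (K / (N / D))"
      using nz K0 N0 key by (simp add: divide_simps) algebra
    show ?thesis unfolding VZ by (simp add: images) (use * in simp)
  qed (simp_all add: images)
qed (intro ratfun_hom_comp homs)+

text \<open>
  For involutions, the relation \<open>(f g)\<^sup>3 = 1\<close> says \<open>f g f = g f g\<close>, and similarly for order four; in the
  second form the composites are shorter.
\<close>

lemma order_3_if_braid:
  assumes "f \<circ> f = id" "g \<circ> g = id" "f \<circ> g \<circ> f = g \<circ> f \<circ> g"
  shows "(f \<circ> g) ^^ 3 = id"
proof -
  have "(f \<circ> g) ^^ 3 = (f \<circ> g \<circ> f) \<circ> (g \<circ> f \<circ> g)"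
    by (simp add: numeral_3_eq_3 o_assoc)
  also have "\<dots> = (g \<circ> f) \<circ> (g \<circ> g) \<circ> (f \<circ> g)"
    by (simp only: assms(3) o_assoc)
  also have "\<dots> = g \<circ> (f \<circ> f) \<circ> g"
    by (simp only: assms(2) o_assoc comp_id)
  also have "\<dots> = id"
    by (simp add: assms(1,2))
  finally show ?thesis .
qed

lemma order_4_if_braid:
  assumes "f \<circ> f = id" "g \<circ> g = id" "f \<circ> g \<circ> f \<circ> g = g \<circ> f \<circ> g \<circ> f"
  shows "(f \<circ> g) ^^ 4 = id"
proof -
  have "(f \<circ> g) ^^ 4 = (f \<circ> g \<circ> f \<circ> g) \<circ> (f \<circ> g \<circ> f \<circ> g)"
    by (simp add: eval_nat_numeral o_assoc)
  also have "\<dots> = (f \<circ> g \<circ> f) \<circ> (g \<circ> g) \<circ> (f \<circ> g \<circ> f)"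
    by (subst (2) assms(3)) (simp only: o_assoc)
  also have "\<dots> = (f \<circ> g) \<circ> (f \<circ> f) \<circ> (g \<circ> f)"
    by (simp only: assms(2) o_assoc comp_id)
  also have "\<dots> = f \<circ> (g \<circ> g) \<circ> f"
    by (simp only: assms(1) o_assoc comp_id)
  also have "\<dots> = id"
    by (simp add: assms(1,2))
  finally show ?thesis .
qed

text \<open>
  Again the denominators are permuted up to factors: \<open>s\<^sub>2\<close> exchanges \<open>Z\<close> with \<open>Q\<close> and \<open>P\<close> with \<open>M\<close> and
  fixes \<open>D\<close> and \<open>R\<close>, while \<open>s\<^sub>3\<close> exchanges \<open>D\<close> with \<open>P\<close> and \<open>Q\<close> with \<open>R\<close> and fixes \<open>Z\<close> and \<open>M\<close>.  The
  parameter \<open>b\<close> is the image of \<open>\<alpha>\<^sub>3\<close> under \<open>s\<^sub>2\<close>, and \<open>s\<^sub>3\<close> fixes it.  Since \<open>s\<^sub>3\<close> fixes \<open>x\<close> and \<open>z\<close>, and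
  \<open>s\<^sub>2\<close> fixes \<open>w\<close>, the relation says that \<open>s\<^sub>2 s\<^sub>3 s\<^sub>2\<close> maps \<open>x\<close> and \<open>z\<close> to invariants of
  \<open>s\<^sub>3\<close>, and that \<open>s\<^sub>3 s\<^sub>2 s\<^sub>3\<close> maps \<open>w\<close> to an invariant of \<open>s\<^sub>2\<close>.
\<close>

lemma braid_s2_s3:
  "act bt_s2 \<circ> act bt_s3 \<circ> act bt_s2 \<circ> act bt_s3
    = act bt_s3 \<circ> act bt_s2 \<circ> act bt_s3 \<circ> act bt_s2"
proof (rule ratfun_hom_eqI)
  define D where "D = D2"
  define b where "b = A3 + 2 * A2"
  define Q where "Q = Z * D + 2 * A2 * Y * W"
  define R where "R = Z * Q - A3 * b * Y"
  define P where "P = Z^2 * D - 2 * Y * W * A3 * Z + Y * A3^2"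
  define M where "M = Q^2 - 2 * Y * W * b * Q + Y * b^2 * D"
  have nz: "D \<noteq> 0" "Y \<noteq> 0" "Z \<noteq> 0"
    using denominators_nonzero unfolding D_def by simp_all
  \<comment> \<open>Writing \<open>w\<^sup>2 - t\<close> as \<open>(D - 1) / y\<close> leaves \<open>D\<close> as the only part of the image of \<open>x\<close> that \<open>s\<^sub>3\<close>
    moves, apart from the parameter.\<close>
  have s2_X: "act bt_s2 X = X + A2 * (1 - 1 / D) / Y"
  proof -
    have "A2 * (W^2 - T) / D = A2 * (1 - 1 / D) / Y"
      using nz by (simp add: divide_simps) (simp add: D_def algebra_simps)
    then show ?thesis by (simp add: s2_rvar flip: D_def)
  qed
  have s2: "act bt_s2 Y = Y" "act bt_s2 W = W" "act bt_s2 T = T"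
    "act bt_s2 A1 = A1 + A2" "act bt_s2 A2 = - A2" "act bt_s2 A3 = b" "act bt_s2 b = A3"
    by (simp_all add: s2_rvar b_def s2.simps)
  have s2_Z: "act bt_s2 Z = Q / D"
    using nz by (simp add: s2_rvar Q_def add_divide_distrib flip: D_def)
  have s2_D: "act bt_s2 D = D"
    by (simp add: D_def s2 s2.simps)
  have s2_Q: "act bt_s2 Q = Z * D"
    using nz by (simp add: Q_def s2 s2_Z s2_D s2.simps)
  have s2_R: "act bt_s2 R = R"
    using nz by (simp add: R_def s2 s2_Z s2_D s2_Q s2.simps)
  have s2_P: "act bt_s2 P = M / D"
    using nz by (simp add: P_def M_def s2 s2_Z s2_D s2.simps) (simp add: field_simps power2_eq_square)
  have s3: "act bt_s3 X = X" "act bt_s3 Y = Y" "act bt_s3 Z = Z" "act bt_s3 W = W - A3 / Z"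
    "act bt_s3 T = T" "act bt_s3 A1 = A1" "act bt_s3 A2 = A2 + A3" "act bt_s3 A3 = - A3"
    "act bt_s3 b = b"
    by (simp_all add: s3_rvar b_def s3.simps)
  have s3_D: "act bt_s3 D = P / Z^2"
    using nz by (simp add: D_def s3 s3.simps P_def) (simp add: field_simps power2_eq_square)
  have s3_Q: "act bt_s3 Q = R / Z"
    using nz by (simp add: Q_def s3 s3_D s3.simps)
      (simp add: R_def Q_def P_def b_def field_simps power2_eq_square)
  have s3_R: "act bt_s3 R = Z * Q"
    using nz by (simp add: R_def s3 s3_Q s3.simps)
  have s3_M: "act bt_s3 M = M"
  proof -
    have "R^2 - 2 * Y * (Z * W - A3) * b * R + Y * b^2 * P = Z^2 * M"
      by (simp add: R_def P_def M_def algebra_simps power2_eq_square)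
    moreover have "act bt_s3 M = (R^2 - 2 * Y * (Z * W - A3) * b * R + Y * b^2 * P) / Z^2"
      using nz by (simp add: M_def s3 s3_Q s3_D s3.simps) (simp add: field_simps power2_eq_square)
    ultimately show ?thesis using nz by simp
  qed
  have nz': "P \<noteq> 0" "Q \<noteq> 0" "R \<noteq> 0" "M \<noteq> 0"
  proof -
    show P: "P \<noteq> 0" using s3.nonzero[OF nz(1)] s3_D by auto
    show Q: "Q \<noteq> 0" using s2.nonzero[OF nz(3)] s2_Z by auto
    show "R \<noteq> 0" using s3.nonzero[OF Q] s3_Q by auto
    show "M \<noteq> 0" using s2.nonzero[OF P] s2_P by auto
  qed
  note images = s2 s2_X s2_Z s2_D s2_Q s2_R s2_P s3 s3_D s3_Q s3_R s3_M hom_simps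
  fix v
  show "(act bt_s2 \<circ> act bt_s3 \<circ> act bt_s2 \<circ> act bt_s3) (rvar v)
      = (act bt_s3 \<circ> act bt_s2 \<circ> act bt_s3 \<circ> act bt_s2) (rvar v)"
  proof (cases v)
    case VX
    have key: "P * (A2 * M + (A2 + A3) * Q^2) = D * ((A2 + A3) * Z^2 * M + A2 * R^2)"
      by (simp add: R_def P_def M_def Q_def b_def algebra_simps power2_eq_square)
    have eq: "A2 / D + (A2 + A3) * Q^2 / (D * M) = (A2 + A3) * Z^2 / P + A2 * R^2 / (P * M)"
    proof -
      have "A2 / D + (A2 + A3) * Q^2 / (D * M) = (P * (A2 * M + (A2 + A3) * Q^2)) / (D * M * P)"
        using nz nz' by (simp add: field_simps)
      also have "\<dots> = (A2 + A3) * Z^2 / P + A2 * R^2 / (P * M)"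
        unfolding key using nz nz' by (simp add: field_simps)
      finally show ?thesis .
    qed
    have 1: "act bt_s3 (act bt_s2 X) = X + (A2 + A3) * (1 - Z^2 / P) / Y"
      by (simp add: images)
    have 2: "act bt_s2 (act bt_s3 (act bt_s2 X))
      = X + A2 * (1 - 1 / D) / Y + (A2 + A3) * (1 - Q^2 / (D * M)) / Y"
      unfolding 1 using nz nz' by (simp add: images) (simp add: field_simps power2_eq_square b_def)
    have 3: "act bt_s3 (act bt_s2 (act bt_s3 (act bt_s2 X)))
      = X + (A2 + A3) * (1 - Z^2 / P) / Y + A2 * (1 - R^2 / (P * M)) / Y"
      unfolding 2 using nz nz' by (simp add: images) (simp add: field_simps power2_eq_square)
    have "A2 * (1 - 1 / D) + (A2 + A3) * (1 - Q^2 / (D * M))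
      = (A2 + A3) * (1 - Z^2 / P) + A2 * (1 - R^2 / (P * M))"
      using eq by (simp add: algebra_simps)
    then show ?thesis
      unfolding VX using 2 3 by (simp add: s3 add.assoc flip: add_divide_distrib)
  next
    case VZ
    then show ?thesis using nz nz' by (simp add: images power2_eq_square)
  next
    case VW
    have key: "A3 * R * Q + b * P * Q = b * D * Z * R + A3 * M * Z"
      by (simp add: R_def P_def M_def b_def algebra_simps power2_eq_square)
    have eq: "A3 / Z + b * P / (Z * R) = b * D / Q + A3 * M / (Q * R)"
    proof -
      have "A3 / Z + b * P / (Z * R) = (A3 * R * Q + b * P * Q) / (Z * R * Q)"
        using nz nz' by (simp add: field_simps)
      also have "\<dots> = b * D / Q + A3 * M / (Q * R)"
        unfolding key using nz nz' by (simp add: field_simps)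
      finally show ?thesis .
    qed
    have 1: "act bt_s3 (act bt_s2 (act bt_s3 W)) = W - (A3 / Z + b * P / (Z * R))"
      using nz nz' by (simp add: images) (simp add: field_simps power2_eq_square)
    have "act bt_s2 (act bt_s3 (act bt_s2 (act bt_s3 W))) = W - (b * D / Q + A3 * M / (Q * R))"
      unfolding 1 using nz nz' by (simp add: images)
    with 1 eq show ?thesis
      unfolding VW by (simp add: s2)
  qed (simp_all add: images)
qed (intro ratfun_hom_comp homs)+

text \<open>
  Conjugation by \<open>\<pi>\<close> turns \<open>s\<^sub>0\<close> into \<open>s\<^sub>1\<close> and fixes \<open>s\<^sub>2\<close>, so this relation is the conjugate of the one
  for \<open>s\<^sub>0\<close> and \<open>s\<^sub>2\<close>.
\<close>

lemma braid_s1_s2: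
  "act bt_s1 \<circ> act bt_s2 \<circ> act bt_s1 = act bt_s2 \<circ> act bt_s1 \<circ> act bt_s2"
proof -
  note [simp] = fun_eq_iff o_apply
  have pi: "act bt_s1 (act bt_pi r) = act bt_pi (act bt_s0 r)"
    "act bt_s2 (act bt_pi r) = act bt_pi (act bt_s2 r)" for r
    using pi_s0 pi_s2 by simp_all
  show ?thesis
  proof
    fix r
    obtain q where "r = act bt_pi q"
      using automorphisms(5) unfolding acts_by_automorphism_def field_automorphism_def
      by (metis bij_pointE)
    then show "(act bt_s1 \<circ> act bt_s2 \<circ> act bt_s1) r = (act bt_s2 \<circ> act bt_s1 \<circ> act bt_s2) r"
      using braid_s0_s2 by (simp add: pi)
  qed
qed

section \<open>Transformation of solutions\<close>

text \<open>
  Along a solution on which \<open>s\<^sub>0\<close> is defined, the denominator \<open>x - 1\<close> has no zero.  The parameter moved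
  is \<open>\<alpha>\<^sub>1\<close>, on which \<open>\<alpha>\<^sub>0\<close> depends; for each of the other transformations it is the parameter in the
  numerator.
\<close>

lemma s0_pole:
  assumes "defined_at id \<theta> (Y - A0 / (X - 1))"
  shows "\<theta> VX \<noteq> 1"
proof
  assume "\<theta> VX = 1"
  show False
  proof (rule defined_at_pole[where v = VA1 and c = "1 - 2 * \<theta> VA2 - \<theta> VA3"])
    have "(y - a / p) * p = y * p - a" if "p \<noteq> 0" for y a p :: ratfun
      using that by (simp add: left_diff_distrib)
    from this[of "X - 1"] show "(Y - A0 / (X - 1)) * (X - 1) = Y * (X - 1) - A0"
      using denominators_nonzero by simp
    show "num.takes_value (\<theta>(VA1 := s)) (X - 1) 0" for s
      by (rule num.takes_value_eqI, (rule num.takes_value_intros)+) (simp add: \<open>\<theta> VX = 1\<close>)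
    show "num.takes_value (\<theta>(VA1 := s)) (Y * (X - 1) - A0) (s + 2 * \<theta> VA2 + \<theta> VA3 - 1)" for s
      by (rule num.takes_value_eqI, (rule num.takes_value_intros)+) (simp add: \<open>\<theta> VX = 1\<close>)
    show "s + 2 * \<theta> VA2 + \<theta> VA3 - 1 \<noteq> 0" if "s \<noteq> 1 - 2 * \<theta> VA2 - \<theta> VA3" for s
      using that by (auto simp: algebra_simps)
  qed (rule assms)
qed

lemma s1_pole:
  assumes "defined_at id \<theta> (Y - A1 / X)"
  shows "\<theta> VX \<noteq> 0"
proof
  assume "\<theta> VX = 0"
  show False
  proof (rule defined_at_pole[where v = VA1 and c = 0])
    show "(Y - A1 / X) * X = Y * X - A1"
      using denominators_nonzero by (simp add: left_diff_distrib)
    show "num.takes_value (\<theta>(VA1 := s)) X 0" for s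
      by (rule num.takes_value_eqI, (rule num.takes_value_intros)+) (simp add: \<open>\<theta> VX = 0\<close>)
    show "num.takes_value (\<theta>(VA1 := s)) (Y * X - A1) (- s)" for s
      by (rule num.takes_value_eqI, (rule num.takes_value_intros)+) (simp add: \<open>\<theta> VX = 0\<close>)
  qed (use assms in auto)
qed

text \<open>
  If the denominator vanishes, then \<open>y * (w\<^sup>2 - t) = - 1\<close>, so the factor \<open>w\<^sup>2 - t\<close> of the numerator
  does not vanish with it.
\<close>

lemma s2_pole:
  assumes "defined_at id \<theta> (X + A2 * (W^2 - T) / D2)"
  shows "\<theta> VY * \<theta> VW ^ 2 - \<theta> VT * \<theta> VY + 1 \<noteq> 0"
proof
  assume D: "\<theta> VY * \<theta> VW ^ 2 - \<theta> VT * \<theta> VY + 1 = 0"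
  have V: "\<theta> VW ^ 2 - \<theta> VT \<noteq> 0"
    using D by (auto simp: algebra_simps)
  show False
  proof (rule defined_at_pole[where v = VA2 and c = 0])
    show "(X + A2 * (W^2 - T) / D2) * D2 = X * D2 + A2 * (W^2 - T)"
      using denominators_nonzero by (simp add: distrib_right)
    show "num.takes_value (\<theta>(VA2 := s)) D2 0" for s
      by (rule num.takes_value_eqI, (rule num.takes_value_intros)+) (simp add: D)
    show "num.takes_value (\<theta>(VA2 := s)) (X * D2 + A2 * (W^2 - T)) (s * (\<theta> VW ^ 2 - \<theta> VT))" for s
      by (rule num.takes_value_eqI, (rule num.takes_value_intros)+) (simp add: D)
  qed (use assms V in auto)
qed

lemma s3_pole:
  assumes "defined_at id \<theta> (W - A3 / Z)"
  shows "\<theta> VZ \<noteq> 0"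
proof
  assume "\<theta> VZ = 0"
  show False
  proof (rule defined_at_pole[where v = VA3 and c = 0])
    show "(W - A3 / Z) * Z = W * Z - A3"
      using denominators_nonzero by (simp add: left_diff_distrib)
    show "num.takes_value (\<theta>(VA3 := s)) Z 0" for s
      by (rule num.takes_value_eqI, (rule num.takes_value_intros)+) (simp add: \<open>\<theta> VZ = 0\<close>)
    show "num.takes_value (\<theta>(VA3 := s)) (W * Z - A3) (- s)" for s
      by (rule num.takes_value_eqI, (rule num.takes_value_intros)+) (simp add: \<open>\<theta> VZ = 0\<close>)
  qed (use assms in auto)
qed

lemma carries_solutions_s0: "carries_solutions bt_s0"
proof (rule carries_solutionsI)
  fix D x y z w a0 a1 a2 a3
  assume sol: "is_solution D x y z w a0 a1 a2 a3"
    and def: "\<And>t r. t \<in> D \<Longrightarrow> r \<in> set_coords bt_s0 \<Longrightarrow>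
      defined_at id (assign (Coords (x t) (y t) (z t) (w t) t a0 a1 a2 a3)) r"
  have a: "a0 = 1 - a1 - 2 * a2 - a3"
    using sol by (simp add: is_solution_iff algebra_simps)
  have pole: "x t \<noteq> 1" if "t \<in> D" for t
    using s0_pole[OF def[OF that, of "Y - A0 / (X - 1)"]] by (simp add: bt_s0_def generic_def)
  let ?y = "\<lambda>t. y t - a0 / (x t - 1)"
  have "is_solution ((\<lambda>t. t) ` D) x ?y z w (- a0) a1 (a2 + a0) a3"
    unfolding is_solution_iff image_ident
  proof (intro conjI ballI)
    show "(- a0) + a1 + 2 * (a2 + a0) + a3 = 1" by (simp add: a algebra_simps)
  next
    fix t assume "t \<in> D"
    note pole = pole[OF \<open>t \<in> D\<close>]
    have pole': "x t - 1 \<noteq> 0" using pole by simp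
    note flow = s0_flow[OF pole]
    have hx: "(x has_field_derivative flow_x a0 a1 t (x t) (y t) / t^2) (at t)"
      and hy: "(y has_field_derivative flow_y a0 a1 a2 a3 t (x t) (y t) (z t) (w t) / t^2) (at t)"
      and hz: "(z has_field_derivative flow_z a0 a1 a2 a3 t (x t) (z t) (w t) / t^2) (at t)"
      and hw: "(w has_field_derivative flow_w a0 a1 a2 a3 t (x t) (z t) (w t) / t^2) (at t)"
      using sol \<open>t \<in> D\<close> by (simp_all add: is_solution_iff)
    show "(x has_field_derivative flow_x (- a0) a1 t (x t) (?y t) / t^2) (at t)"
      using hx by (rule DERIV_cong) (rule arg_cong[OF flow(1), of "\<lambda>u. u / t^2"])
    show "(?y has_field_derivative flow_y (- a0) a1 (a2 + a0) a3 t (x t) (?y t) (z t) (w t) / t^2) (at t)"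
      using DERIV_diff[OF hy DERIV_divide[OF DERIV_const DERIV_diff[OF hx DERIV_const] pole'], of a0]
      by (rule DERIV_cong) (rule flow(2))
    show "(z has_field_derivative flow_z (- a0) a1 (a2 + a0) a3 t (x t) (z t) (w t) / t^2) (at t)"
      using hz by (rule DERIV_cong) (rule arg_cong[OF flow(3), of "\<lambda>u. u / t^2"])
    show "(w has_field_derivative flow_w (- a0) a1 (a2 + a0) a3 t (x t) (z t) (w t) / t^2) (at t)"
      using hw by (rule DERIV_cong) (rule arg_cong[OF flow(4), of "\<lambda>u. u / t^2"])
  qed (use sol in \<open>simp_all add: is_solution_iff\<close>)
  then show "\<exists>\<tau> x' y' z' w' b0 b1 b2 b3. is_solution (\<tau> ` D) x' y' z' w' b0 b1 b2 b3 \<and>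
      (\<forall>t\<in>D. map_coords (reval id (assign (Coords (x t) (y t) (z t) (w t) t a0 a1 a2 a3))) bt_s0
        = Coords (x' (\<tau> t)) (y' (\<tau> t)) (z' (\<tau> t)) (w' (\<tau> t)) (\<tau> t) b0 b1 b2 b3)"
  proof (intro exI conjI ballI)
    fix t assume "t \<in> D"
    show "map_coords (reval id (assign (Coords (x t) (y t) (z t) (w t) t a0 a1 a2 a3))) bt_s0
      = Coords (x t) (?y t) (z t) (w t) t (- a0) a1 (a2 + a0) a3"
      unfolding bt_s0_def generic_def coords.case coords.map coords.inject
      by (intro conjI; rule num.reval_eq; rule num.takes_value_eqI)
        (rule num.takes_value_intros | (simp add: pole[OF \<open>t \<in> D\<close>] a; fail))+
  qed
qed

lemma carries_solutions_s1: "carries_solutions bt_s1"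
proof (rule carries_solutionsI)
  fix D x y z w a0 a1 a2 a3
  assume sol: "is_solution D x y z w a0 a1 a2 a3"
    and def: "\<And>t r. t \<in> D \<Longrightarrow> r \<in> set_coords bt_s1 \<Longrightarrow>
      defined_at id (assign (Coords (x t) (y t) (z t) (w t) t a0 a1 a2 a3)) r"
  have a: "a0 = 1 - a1 - 2 * a2 - a3"
    using sol by (simp add: is_solution_iff algebra_simps)
  have pole: "x t \<noteq> 0" if "t \<in> D" for t
    using s1_pole[OF def[OF that, of "Y - A1 / X"]] by (simp add: bt_s1_def generic_def)
  let ?y = "\<lambda>t. y t - a1 / x t"
  have "is_solution ((\<lambda>t. t) ` D) x ?y z w a0 (- a1) (a2 + a1) a3"
    unfolding is_solution_iff image_ident
  proof (intro conjI ballI)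
    show "a0 + (- a1) + 2 * (a2 + a1) + a3 = 1" by (simp add: a algebra_simps)
  next
    fix t assume "t \<in> D"
    note pole = pole[OF \<open>t \<in> D\<close>]
    note flow = s1_flow[OF pole]
    have hx: "(x has_field_derivative flow_x a0 a1 t (x t) (y t) / t^2) (at t)"
      and hy: "(y has_field_derivative flow_y a0 a1 a2 a3 t (x t) (y t) (z t) (w t) / t^2) (at t)"
      and hz: "(z has_field_derivative flow_z a0 a1 a2 a3 t (x t) (z t) (w t) / t^2) (at t)"
      and hw: "(w has_field_derivative flow_w a0 a1 a2 a3 t (x t) (z t) (w t) / t^2) (at t)"
      using sol \<open>t \<in> D\<close> by (simp_all add: is_solution_iff)
    show "(x has_field_derivative flow_x a0 (- a1) t (x t) (?y t) / t^2) (at t)"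
      using hx by (rule DERIV_cong) (rule arg_cong[OF flow(1), of "\<lambda>u. u / t^2"])
    show "(?y has_field_derivative flow_y a0 (- a1) (a2 + a1) a3 t (x t) (?y t) (z t) (w t) / t^2) (at t)"
      using DERIV_diff[OF hy DERIV_divide[OF DERIV_const hx pole], of a1] by (rule DERIV_cong) (rule flow(2))
    show "(z has_field_derivative flow_z a0 (- a1) (a2 + a1) a3 t (x t) (z t) (w t) / t^2) (at t)"
      using hz by (rule DERIV_cong) (rule arg_cong[OF flow(3), of "\<lambda>u. u / t^2"])
    show "(w has_field_derivative flow_w a0 (- a1) (a2 + a1) a3 t (x t) (z t) (w t) / t^2) (at t)"
      using hw by (rule DERIV_cong) (rule arg_cong[OF flow(4), of "\<lambda>u. u / t^2"])
  qed (use sol in \<open>simp_all add: is_solution_iff\<close>)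
  then show "\<exists>\<tau> x' y' z' w' b0 b1 b2 b3. is_solution (\<tau> ` D) x' y' z' w' b0 b1 b2 b3 \<and>
      (\<forall>t\<in>D. map_coords (reval id (assign (Coords (x t) (y t) (z t) (w t) t a0 a1 a2 a3))) bt_s1
        = Coords (x' (\<tau> t)) (y' (\<tau> t)) (z' (\<tau> t)) (w' (\<tau> t)) (\<tau> t) b0 b1 b2 b3)"
  proof (intro exI conjI ballI)
    fix t assume "t \<in> D"
    show "map_coords (reval id (assign (Coords (x t) (y t) (z t) (w t) t a0 a1 a2 a3))) bt_s1
      = Coords (x t) (?y t) (z t) (w t) t a0 (- a1) (a2 + a1) a3"
      unfolding bt_s1_def generic_def coords.case coords.map coords.inject
      by (intro conjI; rule num.reval_eq; rule num.takes_value_eqI)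
        (rule num.takes_value_intros | (simp add: pole[OF \<open>t \<in> D\<close>] a; fail))+
  qed
qed

lemma carries_solutions_s2: "carries_solutions bt_s2"
proof (rule carries_solutionsI)
  fix D x y z w a0 a1 a2 a3
  assume sol: "is_solution D x y z w a0 a1 a2 a3"
    and def: "\<And>t r. t \<in> D \<Longrightarrow> r \<in> set_coords bt_s2 \<Longrightarrow>
      defined_at id (assign (Coords (x t) (y t) (z t) (w t) t a0 a1 a2 a3)) r"
  have a: "a0 = 1 - a1 - 2 * a2 - a3"
    using sol by (simp add: is_solution_iff algebra_simps)
  have pole: "y t * w t^2 - t * y t + 1 \<noteq> 0" if "t \<in> D" for t
    using s2_pole[OF def[OF that, of "X + A2 * (W^2 - T) / D2"]] by (simp add: bt_s2_def generic_def)
  let ?x = "\<lambda>t. x t + a2 * (w t^2 - t) / (y t * w t^2 - t * y t + 1)"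
  let ?z = "\<lambda>t. z t + 2 * a2 * y t * w t / (y t * w t^2 - t * y t + 1)"
  have "is_solution ((\<lambda>t. t) ` D) ?x y ?z w (a0 + a2) (a1 + a2) (- a2) (a3 + 2 * a2)"
    unfolding is_solution_iff image_ident
  proof (intro conjI ballI)
    show "(a0 + a2) + (a1 + a2) + 2 * (- a2) + (a3 + 2 * a2) = 1" by (simp add: a algebra_simps)
  next
    fix t assume "t \<in> D"
    then have t: "t \<noteq> 0" using sol by (auto simp: is_solution_iff)
    note pole = pole[OF \<open>t \<in> D\<close>]
    note flow = s2_flow[OF pole t, OF a]
    have hx: "(x has_field_derivative flow_x a0 a1 t (x t) (y t) / t^2) (at t)"
      and hy: "(y has_field_derivative flow_y a0 a1 a2 a3 t (x t) (y t) (z t) (w t) / t^2) (at t)"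
      and hz: "(z has_field_derivative flow_z a0 a1 a2 a3 t (x t) (z t) (w t) / t^2) (at t)"
      and hw: "(w has_field_derivative flow_w a0 a1 a2 a3 t (x t) (z t) (w t) / t^2) (at t)"
      using sol \<open>t \<in> D\<close> by (simp_all add: is_solution_iff)
    let ?fy = "flow_y a0 a1 a2 a3 t (x t) (y t) (z t) (w t)"
    let ?fw = "flow_w a0 a1 a2 a3 t (x t) (z t) (w t)"
    have hV: "((\<lambda>t. a2 * (w t^2 - t)) has_field_derivative a2 * (2 * w t * (?fw / t^2) - 1)) (at t)"
      by (auto intro!: derivative_eq_intros hw)
    have hYW: "((\<lambda>t. 2 * a2 * y t * w t) has_field_derivative
        2 * a2 * (?fy / t^2 * w t + y t * (?fw / t^2))) (at t)"
      by (auto intro!: derivative_eq_intros hy hw simp: algebra_simps)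
    have hD: "((\<lambda>t. y t * w t^2 - t * y t + 1) has_field_derivative
        ?fy / t^2 * (w t^2 - t) + y t * (2 * w t * (?fw / t^2) - 1)) (at t)"
      by (auto intro!: derivative_eq_intros hy hw simp: algebra_simps diff_divide_distrib)
    show "(?x has_field_derivative flow_x (a0 + a2) (a1 + a2) t (?x t) (y t) / t^2) (at t)"
      using DERIV_add[OF hx DERIV_divide[OF hV hD pole]] by (rule DERIV_cong) (rule flow(1))
    show "(y has_field_derivative flow_y (a0 + a2) (a1 + a2) (- a2) (a3 + 2 * a2) t (?x t) (y t) (?z t) (w t) / t^2) (at t)"
      using hy by (rule DERIV_cong) (rule arg_cong[OF flow(2), of "\<lambda>u. u / t^2"])
    show "(?z has_field_derivative flow_z (a0 + a2) (a1 + a2) (- a2) (a3 + 2 * a2) t (?x t) (?z t) (w t) / t^2) (at t)"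
      using DERIV_add[OF hz DERIV_divide[OF hYW hD pole]] by (rule DERIV_cong) (rule flow(3))
    show "(w has_field_derivative flow_w (a0 + a2) (a1 + a2) (- a2) (a3 + 2 * a2) t (?x t) (?z t) (w t) / t^2) (at t)"
      using hw by (rule DERIV_cong) (rule arg_cong[OF flow(4), of "\<lambda>u. u / t^2"])
  qed (use sol in \<open>simp_all add: is_solution_iff\<close>)
  then show "\<exists>\<tau> x' y' z' w' b0 b1 b2 b3. is_solution (\<tau> ` D) x' y' z' w' b0 b1 b2 b3 \<and>
      (\<forall>t\<in>D. map_coords (reval id (assign (Coords (x t) (y t) (z t) (w t) t a0 a1 a2 a3))) bt_s2
        = Coords (x' (\<tau> t)) (y' (\<tau> t)) (z' (\<tau> t)) (w' (\<tau> t)) (\<tau> t) b0 b1 b2 b3)"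
  proof (intro exI conjI ballI)
    fix t assume "t \<in> D"
    show "map_coords (reval id (assign (Coords (x t) (y t) (z t) (w t) t a0 a1 a2 a3))) bt_s2
      = Coords (?x t) (y t) (?z t) (w t) t (a0 + a2) (a1 + a2) (- a2) (a3 + 2 * a2)"
      unfolding bt_s2_def generic_def coords.case coords.map coords.inject
      by (intro conjI; rule num.reval_eq; rule num.takes_value_eqI)
        (rule num.takes_value_intros | (simp add: pole[OF \<open>t \<in> D\<close>] a; fail))+
  qed
qed

lemma carries_solutions_s3: "carries_solutions bt_s3"
proof (rule carries_solutionsI)
  fix D x y z w a0 a1 a2 a3
  assume sol: "is_solution D x y z w a0 a1 a2 a3"
    and def: "\<And>t r. t \<in> D \<Longrightarrow> r \<in> set_coords bt_s3 \<Longrightarrow>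
      defined_at id (assign (Coords (x t) (y t) (z t) (w t) t a0 a1 a2 a3)) r"
  have a: "a0 = 1 - a1 - 2 * a2 - a3"
    using sol by (simp add: is_solution_iff algebra_simps)
  have pole: "z t \<noteq> 0" if "t \<in> D" for t
    using s3_pole[OF def[OF that, of "W - A3 / Z"]] by (simp add: bt_s3_def generic_def)
  let ?w = "\<lambda>t. w t - a3 / z t"
  have "is_solution ((\<lambda>t. t) ` D) x y z ?w a0 a1 (a2 + a3) (- a3)"
    unfolding is_solution_iff image_ident
  proof (intro conjI ballI)
    show "a0 + a1 + 2 * (a2 + a3) + (- a3) = 1" by (simp add: a algebra_simps)
  next
    fix t assume "t \<in> D"
    note pole = pole[OF \<open>t \<in> D\<close>]
    note flow = s3_flow[OF pole]
    have hx: "(x has_field_derivative flow_x a0 a1 t (x t) (y t) / t^2) (at t)"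
      and hy: "(y has_field_derivative flow_y a0 a1 a2 a3 t (x t) (y t) (z t) (w t) / t^2) (at t)"
      and hz: "(z has_field_derivative flow_z a0 a1 a2 a3 t (x t) (z t) (w t) / t^2) (at t)"
      and hw: "(w has_field_derivative flow_w a0 a1 a2 a3 t (x t) (z t) (w t) / t^2) (at t)"
      using sol \<open>t \<in> D\<close> by (simp_all add: is_solution_iff)
    show "(x has_field_derivative flow_x a0 a1 t (x t) (y t) / t^2) (at t)"
      using hx .
    show "(y has_field_derivative flow_y a0 a1 (a2 + a3) (- a3) t (x t) (y t) (z t) (?w t) / t^2) (at t)"
      using hy by (rule DERIV_cong) (rule arg_cong[OF flow(1), of "\<lambda>u. u / t^2"])
    show "(z has_field_derivative flow_z a0 a1 (a2 + a3) (- a3) t (x t) (z t) (?w t) / t^2) (at t)"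
      using hz by (rule DERIV_cong) (rule arg_cong[OF flow(2), of "\<lambda>u. u / t^2"])
    show "(?w has_field_derivative flow_w a0 a1 (a2 + a3) (- a3) t (x t) (z t) (?w t) / t^2) (at t)"
      using DERIV_diff[OF hw DERIV_divide[OF DERIV_const hz pole], of a3] by (rule DERIV_cong) (rule flow(3))
  qed (use sol in \<open>simp_all add: is_solution_iff\<close>)
  then show "\<exists>\<tau> x' y' z' w' b0 b1 b2 b3. is_solution (\<tau> ` D) x' y' z' w' b0 b1 b2 b3 \<and>
      (\<forall>t\<in>D. map_coords (reval id (assign (Coords (x t) (y t) (z t) (w t) t a0 a1 a2 a3))) bt_s3
        = Coords (x' (\<tau> t)) (y' (\<tau> t)) (z' (\<tau> t)) (w' (\<tau> t)) (\<tau> t) b0 b1 b2 b3)"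
  proof (intro exI conjI ballI)
    fix t assume "t \<in> D"
    show "map_coords (reval id (assign (Coords (x t) (y t) (z t) (w t) t a0 a1 a2 a3))) bt_s3
      = Coords (x t) (y t) (z t) (?w t) t a0 a1 (a2 + a3) (- a3)"
      unfolding bt_s3_def generic_def coords.case coords.map coords.inject
      by (intro conjI; rule num.reval_eq; rule num.takes_value_eqI)
        (rule num.takes_value_intros | (simp add: pole[OF \<open>t \<in> D\<close>] a; fail))+
  qed
qed

lemma carries_solutions_pi: "carries_solutions bt_pi"
proof (rule carries_solutionsI)
  fix D x y z w a0 a1 a2 a3
  assume sol: "is_solution D x y z w a0 a1 a2 a3"
  have a: "a0 = 1 - a1 - 2 * a2 - a3"
    using sol by (simp add: is_solution_iff algebra_simps)
  let ?x = "\<lambda>s. 1 - x (- s)" and ?y = "\<lambda>s. - y (- s)"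
    and ?z = "\<lambda>s. \<i> * z (- s)" and ?w = "\<lambda>s. w (- s) / \<i>"
  have "is_solution ((\<lambda>t. - t) ` D) ?x ?y ?z ?w a1 a0 a2 a3"
    unfolding is_solution_iff
  proof (intro conjI ballI)
    show "open ((\<lambda>t. - t) ` D)"
      using sol by (simp add: is_solution_iff open_negations)
    show "a1 + a0 + 2 * a2 + a3 = 1" by (simp add: a)
  next
    fix s assume "s \<in> (\<lambda>t. - t) ` D"
    then obtain t where "t \<in> D" and s: "s = - t" by blast
    have reflect: "((\<lambda>s. f (- s)) has_field_derivative - c) (at s)"
      if "(f has_field_derivative c) (at t)" for f :: "complex \<Rightarrow> complex" and c
    proof -
      have "((\<lambda>s. - s) has_field_derivative - 1) (at s)"
        by (auto intro!: derivative_eq_intros)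
      then show ?thesis
        using DERIV_chain2[of f c "\<lambda>s. - s" s "- 1" UNIV] that by (simp add: s)
    qed
    have hx: "((\<lambda>s. x (- s)) has_field_derivative - (flow_x a0 a1 t (x t) (y t) / t^2)) (at s)"
      and hy: "((\<lambda>s. y (- s)) has_field_derivative
        - (flow_y a0 a1 a2 a3 t (x t) (y t) (z t) (w t) / t^2)) (at s)"
      and hz: "((\<lambda>s. z (- s)) has_field_derivative - (flow_z a0 a1 a2 a3 t (x t) (z t) (w t) / t^2)) (at s)"
      and hw: "((\<lambda>s. w (- s)) has_field_derivative - (flow_w a0 a1 a2 a3 t (x t) (z t) (w t) / t^2)) (at s)"
      using sol \<open>t \<in> D\<close> by (simp_all add: is_solution_iff reflect)
    show "(?x has_field_derivative flow_x a1 a0 s (?x s) (?y s) / s^2) (at s)"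
      using DERIV_diff[OF DERIV_const hx, of 1]
      by (rule DERIV_cong) (simp add: s pi_flow(1)[symmetric])
    show "(?y has_field_derivative flow_y a1 a0 a2 a3 s (?x s) (?y s) (?z s) (?w s) / s^2) (at s)"
      using DERIV_minus[OF hy]
      by (rule DERIV_cong) (simp only: s minus_minus pi_flow(2)[symmetric] power2_minus)
    show "(?z has_field_derivative flow_z a1 a0 a2 a3 s (?x s) (?z s) (?w s) / s^2) (at s)"
      using DERIV_cmult[OF hz, of \<i>]
      by (rule DERIV_cong) (simp only: s minus_minus pi_flow(3)[symmetric] power2_minus, simp)
    show "(?w has_field_derivative flow_w a1 a0 a2 a3 s (?x s) (?z s) (?w s) / s^2) (at s)"
      using DERIV_cdivide[OF hw, of \<i>]
      by (rule DERIV_cong) (simp only: s minus_minus pi_flow(4)[symmetric] power2_minus, simp)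
  qed (use sol in \<open>auto simp: is_solution_iff\<close>)
  then show "\<exists>\<tau> x' y' z' w' b0 b1 b2 b3. is_solution (\<tau> ` D) x' y' z' w' b0 b1 b2 b3 \<and>
      (\<forall>t\<in>D. map_coords (reval id (assign (Coords (x t) (y t) (z t) (w t) t a0 a1 a2 a3))) bt_pi
        = Coords (x' (\<tau> t)) (y' (\<tau> t)) (z' (\<tau> t)) (w' (\<tau> t)) (\<tau> t) b0 b1 b2 b3)"
  proof (intro exI conjI ballI)
    fix t assume "t \<in> D"
    show "map_coords (reval id (assign (Coords (x t) (y t) (z t) (w t) t a0 a1 a2 a3))) bt_pi
      = Coords (?x (- t)) (?y (- t)) (?z (- t)) (?w (- t)) (- t) a1 a0 a2 a3"
      unfolding bt_pi_def generic_def coords.case coords.map coords.inject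
      by (intro conjI; rule num.reval_eq; rule num.takes_value_eqI)
        (rule num.takes_value_intros | (simp add: a; fail))+
  qed
qed

section \<open>The affine Weyl group symmetry\<close>

theorem theorem4p2:
  shows "(\<forall>f\<in>{bt_s0, bt_s1, bt_s2, bt_s3, bt_pi}.
            baecklund_transformation f \<and> acts_by_automorphism f) \<and>
         act bt_s0 \<circ> act bt_s0 = id \<and>
         act bt_s1 \<circ> act bt_s1 = id \<and>
         act bt_s2 \<circ> act bt_s2 = id \<and>
         act bt_s3 \<circ> act bt_s3 = id \<and>
         (act bt_s0 \<circ> act bt_s2) ^^ 3 = id \<and>
         (act bt_s1 \<circ> act bt_s2) ^^ 3 = id \<and>
         (act bt_s2 \<circ> act bt_s3) ^^ 4 = id \<and>
         act bt_s0 \<circ> act bt_s1 = act bt_s1 \<circ> act bt_s0 \<and>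
         act bt_s0 \<circ> act bt_s3 = act bt_s3 \<circ> act bt_s0 \<and>
         act bt_s1 \<circ> act bt_s3 = act bt_s3 \<circ> act bt_s1 \<and>
         act bt_pi \<circ> act bt_s0 = act bt_s1 \<circ> act bt_pi \<and>
         act bt_pi \<circ> act bt_s1 = act bt_s0 \<circ> act bt_pi \<and>
         act bt_pi \<circ> act bt_s2 = act bt_s2 \<circ> act bt_pi \<and>
         act bt_pi \<circ> act bt_s3 = act bt_s3 \<circ> act bt_pi"
proof (intro conjI ballI)
  fix f assume "f \<in> {bt_s0, bt_s1, bt_s2, bt_s3, bt_pi}"
  then show "baecklund_transformation f" "acts_by_automorphism f"
    using birational_s0 birational_s1 birational_s2 birational_s3 birational_pi
      carries_solutions_s0 carries_solutions_s1 carries_solutions_s2 carries_solutions_s3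
      carries_solutions_pi automorphisms
    by (auto simp: baecklund_transformation_def)
next
  show "(act bt_s0 \<circ> act bt_s2) ^^ 3 = id"
    using involutions(1,3) braid_s0_s2 by (rule order_3_if_braid)
  show "(act bt_s1 \<circ> act bt_s2) ^^ 3 = id"
    using involutions(2,3) braid_s1_s2 by (rule order_3_if_braid)
  show "(act bt_s2 \<circ> act bt_s3) ^^ 4 = id"
    using involutions(3,4) braid_s2_s3 by (rule order_4_if_braid)
qed (fact involutions commutes_s0_s1 commutes_s0_s3 commutes_s1_s3 pi_s0 pi_s1 pi_s2 pi_s3)+

end
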